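(* For $\nu\in V^d_{N,S}$ the polynomials $$Q_\nu(x;\sigma,N)=\frac{(-1)^{|\nu|}}{(-N)_{|\nu|}}\prod_{j=1}^d\frac{(\sigma_j+1)_{\nu_j}}{(a_j+1)_{\nu_j}}(-N+|X_{j-1}|+|\nu^{j+1}|)_{\nu_j}\,Q_{\nu_j}\big(x_j;\sigma_j,a_j,N-|X_{j-1}|-|\nu^{j+1}|\big),$$ where $a_j=|\sigma^{j+1}|+2|\nu^{j+1}|+d-j$, satisfy the difference equation $DQ_\nu=\lambda_{|\nu|}Q_\nu$ in $\mathbb{R}[V^d_{N,S}]$ (i.e. at every point of $V^d_{N,S}$), where $\lambda_n=-n(n+|\sigma|+d)$ and $$D=\sum_{i=1}^dx_i(N-x_i+|\sigma|-\sigma_i+d)\triangle_i\nabla_i-\sum_{1\le i\ne j\le d}x_j(x_i+\sigma_i+1)\triangle_i\nabla_j+\sum_{i=1}^d\big[(N-x_i)(\sigma_i+1)-x_i(|\sigma|-\sigma_i+d)\big]\triangle_i,$$ and, for $\nu,\mu\in V^d_{N,S}$, the orthogonality relation $$\sum_{x\in V^d_{N,S}}Q_\nu(x;\sigma,N)Q_\mu(x;\sigma,N)\prod_{i=1}^d\binom{x_i+\sigma_i}{x_i}\binom{N-|x|+\sigma_{d+1}}{N-|x|}=A_\nu\delta_{\nu,\mu},$$ where $$A_\nu=\frac{(-1)^{|\nu|}(|\sigma|+d+2|\nu|+1)_{N-|\nu|}}{(-N)_{|\nu|}\,N!}\prod_{j=1}^d\frac{(\sigma_j+a_j+\nu_j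+1)_{\nu_j}(\sigma_j+1)_{\nu_j}\nu_j!}{(a_j+1)_{\nu_j}}.$$
   Context: $d>1$, $N$ a positive integer; $\triangle_if(x)=f(x+e_i)-f(x)$, $\nabla_if(x)=f(x)-f(x-e_i)$; $(y)_k=y(y+1)\cdots(y+k-1)$, $(y)_0=1$; $\binom{k+y}{k}=(y+1)_k/k!$ for $k\in\mathbb{N}_0$. $S\subset\{1,\dots,d\}$ is nonempty and, for $i\in S$, $l_i$ is an integer with $1\le l_i\le N-1$; if $S=\{1,\dots,d\}$ it is also assumed that $l_1+\dots+l_d>N$. $V^d_{N,S}=\{x\in\mathbb{N}_0^d:x_1+\dots+x_d\le N,\ x_i\le l_i\text{ for }i\in S\}$. $\mathbb{R}[V]$ is the quotient of $\mathbb{R}[x_1,\dots,x_d]$ by the ideal of polynomials vanishing on $V$. $\sigma=(\sigma_1,\dots,\sigma_{d+1})\in\mathbb{R}^{d+1}$ with $\sigma_i=-l_i-1$ for $i\in S$, $-\sigma_i\notin\{1,\dots,N\}$ for $i\in\{1,\dots,d\}\setminus S$, and such that the weight $\prod_{i=1}^d\binom{x_i+\sigma_i}{x_i}\binom{N-|x|+\sigma_{d+1}}{N-|x|}$ is nonzero and of constant sign on $V^d_{N,S}$. For a vector $y$, $|y|$ is the sum of its coordinates; $|\sigma|=\sigma_1+\dots+\sigma_{d+1}$, $|\sigma^{j+1}|=\sigma_{j+1}+\dots+\sigma_{d+1}$, $|\nu^{j+1}|=\nu_{j+1}+\dots+\nu_d$ (zero for $j=d$), $|X_{j-1}|=x_1+\dots+x_{j-1}$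 (zero for $j=1$). Hahn polynomials: $Q_n(x;\alpha,\beta',M)=\sum_{k=0}^n\frac{(-n)_k(n+\alpha+\beta'+1)_k(-x)_k}{(\alpha+1)_k(-M)_k\,k!}$; the products $(-M)_nQ_n(x;\alpha,\beta',M)$ are understood as polynomials in $M$ and $x$, i.e. with $(-M)_n/(-M)_k=(-M+k)_{n-k}$. *)

theory Defs
  imports Complex_Main
begin

text \<open>
  Vectors are functions on \<open>nat\<close>, with coordinates indexed from 1. The points of \<open>V\<close> and the
  multi-indices \<open>\<nu>\<close> vanish outside \<open>{1..d}\<close>, so that \<open>V\<close> is a finite set and equality of its
  elements is equality of the \<open>d\<close> coordinates. The parameter vector \<open>\<sigma>\<close> is only evaluated
  on \<open>{1..d+1}\<close>.
\<close>

definition V_set :: "nat \<Rightarrow> nat \<Rightarrow> nat set \<Rightarrow> (nat \<Rightarrow> nat) \<Rightarrow> (nat \<Rightarrow> nat) set" where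
  "V_set d N S l = {x. (\<forall>i. i \<notin> {1..d} \<longrightarrow> x i = 0) \<and> (\<Sum>i=1..d. x i) \<le> N \<and> (\<forall>i\<in>S. x i \<le> l i)}"

definition vec_real :: "(nat \<Rightarrow> nat) \<Rightarrow> nat \<Rightarrow> real" where
  "vec_real x = (\<lambda>i. real (x i))"

definition fwd_diff :: "nat \<Rightarrow> ((nat \<Rightarrow> real) \<Rightarrow> real) \<Rightarrow> (nat \<Rightarrow> real) \<Rightarrow> real" where
  "fwd_diff i f = (\<lambda>x. f (x(i := x i + 1)) - f x)"

definition bwd_diff :: "nat \<Rightarrow> ((nat \<Rightarrow> real) \<Rightarrow> real) \<Rightarrow> (nat \<Rightarrow> real) \<Rightarrow> real" where
  "bwd_diff i f = (\<lambda>x. f x - f (x(i := x i - 1)))"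

definition shifted_binom :: "nat \<Rightarrow> real \<Rightarrow> real" where
  "shifted_binom k y = pochhammer (y + 1) k / fact k"

lemma shifted_binom_eq_gbinomial: "shifted_binom k y = (real k + y) gchoose k"
  by (simp add: shifted_binom_def gbinomial_pochhammer' algebra_simps)

definition hahn_weight :: "nat \<Rightarrow> nat \<Rightarrow> (nat \<Rightarrow> real) \<Rightarrow> (nat \<Rightarrow> nat) \<Rightarrow> real" where
  "hahn_weight d N \<sigma> x =
     (\<Prod>i=1..d. shifted_binom (x i) (\<sigma> i)) *
     shifted_binom (N - (\<Sum>i=1..d. x i)) (\<sigma> (d + 1))"

definition hahn_Q :: "nat \<Rightarrow> real \<Rightarrow> real \<Rightarrow> real \<Rightarrow> real \<Rightarrow> real" where
  "hahn_Q n x \<alpha> \<beta> M =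
     (\<Sum>k\<le>n. pochhammer (- real n) k * pochhammer (real n + \<alpha> + \<beta> + 1) k * pochhammer (- x) k /
            (pochhammer (\<alpha> + 1) k * pochhammer (- M) k * fact k))"

text \<open>
  The product \<open>(-M)\<^sub>n Q\<^sub>n(x; \<alpha>, \<beta>, M)\<close>, read as a polynomial in \<open>M\<close> and \<open>x\<close>: each quotient
  \<open>(-M)\<^sub>n / (-M)\<^sub>k\<close> is replaced by \<open>(-M + k)\<^sub>n\<^sub>-\<^sub>k\<close>, so that no denominator depends on \<open>M\<close>.
\<close>

definition hahn_Q_scaled :: "nat \<Rightarrow> real \<Rightarrow> real \<Rightarrow> real \<Rightarrow> real \<Rightarrow> real" where
  "hahn_Q_scaled n x \<alpha> \<beta> M =
     (\<Sum>k\<le>n. pochhammer (- real n) k * pochhammer (real n + \<alpha> + \<beta> + 1) k * pochhammer (- x) k /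
            (pochhammer (\<alpha> + 1) k * fact k) * pochhammer (- M + real k) (n - k))"

lemma hahn_Q_scaled_eq:
  assumes "pochhammer (- M) n \<noteq> 0"
  shows "hahn_Q_scaled n x \<alpha> \<beta> M = pochhammer (- M) n * hahn_Q n x \<alpha> \<beta> M"
  unfolding hahn_Q_scaled_def hahn_Q_def sum_distrib_left
proof (rule sum.cong[OF refl])
  fix k assume "k \<in> {..n}"
  then have *: "pochhammer (- M) n = pochhammer (- M) k * pochhammer (- M + real k) (n - k)"
    by (simp add: pochhammer_product)
  with assms have "pochhammer (- M) k \<noteq> 0" by auto
  then show "pochhammer (- real n) k * pochhammer (real n + \<alpha> + \<beta> + 1) k * pochhammer (- x) k /
        (pochhammer (\<alpha> + 1) k * fact k) * pochhammer (- M + real k) (n - k) =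
      pochhammer (- M) n *
        (pochhammer (- real n) k * pochhammer (real n + \<alpha> + \<beta> + 1) k * pochhammer (- x) k /
          (pochhammer (\<alpha> + 1) k * pochhammer (- M) k * fact k))"
    by (simp add: * divide_simps)
qed

definition hahn_a :: "nat \<Rightarrow> (nat \<Rightarrow> real) \<Rightarrow> (nat \<Rightarrow> nat) \<Rightarrow> nat \<Rightarrow> real" where
  "hahn_a d \<sigma> \<nu> j =
     (\<Sum>i=j+1..d+1. \<sigma> i) + 2 * real (\<Sum>i=j+1..d. \<nu> i) + real d - real j"

definition multi_hahn_Q :: "nat \<Rightarrow> nat \<Rightarrow> (nat \<Rightarrow> real) \<Rightarrow> (nat \<Rightarrow> nat) \<Rightarrow> (nat \<Rightarrow> real) \<Rightarrow> real" where
  "multi_hahn_Q d N \<sigma> \<nu> x =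
     (- 1) ^ (\<Sum>i=1..d. \<nu> i) / pochhammer (- real N) (\<Sum>i=1..d. \<nu> i) *
     (\<Prod>j=1..d. pochhammer (\<sigma> j + 1) (\<nu> j) / pochhammer (hahn_a d \<sigma> \<nu> j + 1) (\<nu> j) *
        hahn_Q_scaled (\<nu> j) (x j) (\<sigma> j) (hahn_a d \<sigma> \<nu> j)
          (real N - (\<Sum>i=1..<j. x i) - real (\<Sum>i=j+1..d. \<nu> i)))"

definition hahn_D :: "nat \<Rightarrow> nat \<Rightarrow> (nat \<Rightarrow> real) \<Rightarrow> ((nat \<Rightarrow> real) \<Rightarrow> real) \<Rightarrow> (nat \<Rightarrow> real) \<Rightarrow> real" where
  "hahn_D d N \<sigma> f x =
     (\<Sum>i=1..d. x i * (real N - x i + (\<Sum>m=1..d+1. \<sigma> m) - \<sigma> i + real d) *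
        fwd_diff i (bwd_diff i f) x)
     - (\<Sum>i=1..d. \<Sum>j\<in>{1..d} - {i}. x j * (x i + \<sigma> i + 1) * fwd_diff i (bwd_diff j f) x)
     + (\<Sum>i=1..d. ((real N - x i) * (\<sigma> i + 1) - x i * ((\<Sum>m=1..d+1. \<sigma> m) - \<sigma> i + real d)) *
        fwd_diff i f x)"

definition hahn_eigenvalue :: "nat \<Rightarrow> (nat \<Rightarrow> real) \<Rightarrow> nat \<Rightarrow> real" where
  "hahn_eigenvalue d \<sigma> n = - real n * (real n + (\<Sum>m=1..d+1. \<sigma> m) + real d)"

definition hahn_norm :: "nat \<Rightarrow> nat \<Rightarrow> (nat \<Rightarrow> real) \<Rightarrow> (nat \<Rightarrow> nat) \<Rightarrow> real" where
  "hahn_norm d N \<sigma> \<nu> =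
     (- 1) ^ (\<Sum>i=1..d. \<nu> i) *
     pochhammer ((\<Sum>m=1..d+1. \<sigma> m) + real d + 2 * real (\<Sum>i=1..d. \<nu> i) + 1) (N - (\<Sum>i=1..d. \<nu> i)) /
     (pochhammer (- real N) (\<Sum>i=1..d. \<nu> i) * fact N) *
     (\<Prod>j=1..d. pochhammer (\<sigma> j + hahn_a d \<sigma> \<nu> j + real (\<nu> j) + 1) (\<nu> j) *
        pochhammer (\<sigma> j + 1) (\<nu> j) * fact (\<nu> j) /
        pochhammer (hahn_a d \<sigma> \<nu> j + 1) (\<nu> j))"

end

theory Submission
  imports Defs
begin

text \<open>
  Multiplying \<open>(-M)\<^sub>n Q\<^sub>n(x; \<alpha>, \<beta>, M)\<close> by \<open>(\<alpha> + 1)\<^sub>n\<close> removes the last denominator and gives a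
  polynomial \<open>R\<^sub>n\<close> in all of \<open>x\<close>, \<open>\<alpha>\<close>, \<open>\<beta>\<close> and \<open>M\<close> (\<open>hahn_R\<close>). Every identity used about \<open>R\<^sub>n\<close> is an
  unconditional polynomial identity, so degenerate parameters, in particular \<open>\<sigma>\<^sub>i = -l\<^sub>i - 1\<close>, need no
  limit argument. Up to a constant, \<open>Q\<^sub>\<nu>\<close> is the product of the polynomials \<open>R\<close> with
  degrees \<open>\<nu>\<^sub>j\<close> (\<open>multi_hahn_Q_eq\<close>; only here \<open>(\<sigma>\<^sub>j + 1)\<^bsub>\<nu>\<^sub>j\<^esub> \<noteq> 0\<close> is needed). If some
  \<open>(a\<^sub>j + 1)\<^bsub>\<nu>\<^sub>j\<^esub>\<close> vanishes then, as \<open>t / 0 = 0\<close>, both \<open>Q\<^sub>\<nu>\<close> and \<open>A\<^sub>\<nu>\<close> are zero and both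
  claims hold trivially.

  In one variable, the forward difference maps \<open>R\<^sub>n\<close> to a multiple of \<open>R\<^sub>n\<^sub>-\<^sub>1\<close> with parameters
  \<open>\<alpha> + 1, \<beta> + 1, M - 1\<close> (\<open>hahn_R_lowering\<close>), and its adjoint with respect to the weights maps that
  polynomial back to \<open>R\<^sub>n\<close> (\<open>hahn_R_raising\<close>, \<open>hahn_ip_adjoint\<close>). Composing the two gives the
  one-variable difference equation; moving one to the other side of the inner product reduces
  the orthogonality relation to degree zero, that is, to the Chu-Vandermonde identity.

  Both multivariate claims follow by induction on \<open>d\<close>, splitting off \<open>x\<^sub>d\<close>. With \<open>n = \<nu>\<^sub>d\<close>, the factors
  with \<open>j < d\<close> form the \<open>(d-1)\<close>-variable product for \<open>N - n\<close> and the parameters in which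
  \<open>\<sigma>\<^sub>d, \<sigma>\<^sub>d\<^sub>+\<^sub>1\<close> are merged into the single last parameter \<open>\<sigma>\<^sub>d + \<sigma>\<^sub>d\<^sub>+\<^sub>1 + 2 n + 1\<close>. For the orthogonality,
  summing over \<open>x\<^sub>d\<close> with the other variables fixed yields the squared norm of \<open>R\<^sub>n\<close>, and this is a
  constant times exactly the last weight factor of the merged problem. The sum over \<open>V\<close> may be replaced by
  the sum over the whole simplex, since for \<open>\<sigma>\<^sub>i = -l\<^sub>i - 1\<close> the weight vanishes where \<open>x\<^sub>i > l\<^sub>i\<close>.

  For the difference equation, put \<open>x\<^sub>d\<^sub>+\<^sub>1 = N - |x|\<close>. The operator \<open>D\<close> is then the hopping operator
  \<open>\<Sum> x\<^sub>j (x\<^sub>i + \<sigma>\<^sub>i + 1) (f(x + e\<^sub>i - e\<^sub>j) - f(x))\<close>, summed over \<open>i \<noteq> j\<close> in \<open>{1..d+1}\<close>, with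
  \<open>e\<^sub>d\<^sub>+\<^sub>1 = 0\<close> (\<open>hahn_D_eq_hop\<close>). Hops between \<open>d\<close> and \<open>d + 1\<close> act on the last factor alone, by the
  one-variable operator. The hops between some \<open>i < d\<close> and either of \<open>d\<close>, \<open>d + 1\<close> combine, by the contiguous
  relations \<open>hahn_R_remove_one\<close> and \<open>hahn_R_add_one\<close>, to the hops between \<open>i\<close> and the merged last site
  (\<open>hop_Suc\<close>).
\<close>

section \<open>Hahn polynomials without denominators\<close>

text \<open>\<open>(\<alpha> + 1)\<^sub>n (-M)\<^sub>n Q\<^sub>n(x; \<alpha>, \<beta>, M)\<close>, with the quotients \<open>(\<alpha> + 1)\<^sub>n / (\<alpha> + 1)\<^sub>k\<close> and
  \<open>(-M)\<^sub>n / (-M)\<^sub>k\<close> written as \<open>(\<alpha> + 1 + k)\<^sub>n\<^sub>-\<^sub>k\<close> and \<open>(-M + k)\<^sub>n\<^sub>-\<^sub>k\<close>.\<close>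

definition hahn_R :: "nat \<Rightarrow> real \<Rightarrow> real \<Rightarrow> real \<Rightarrow> real \<Rightarrow> real" where
  "hahn_R n \<alpha> \<beta> M x =
     (\<Sum>k\<le>n. pochhammer (- real n) k * pochhammer (real n + \<alpha> + \<beta> + 1) k *
        pochhammer (\<alpha> + 1 + real k) (n - k) * pochhammer (- M + real k) (n - k) / fact k *
        pochhammer (- x) k)"

lemma hahn_R_eq_scaled:
  assumes "pochhammer (\<alpha> + 1) n \<noteq> 0"
  shows "hahn_R n \<alpha> \<beta> M x = pochhammer (\<alpha> + 1) n * hahn_Q_scaled n x \<alpha> \<beta> M"
  unfolding hahn_R_def hahn_Q_scaled_def sum_distrib_left
proof (rule sum.cong[OF refl])
  fix k assume "k \<in> {..n}"
  then have *: "pochhammer (\<alpha> + 1) n = pochhammer (\<alpha> + 1) k * pochhammer (\<alpha> + 1 + real k) (n - k)"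
    by (simp add: pochhammer_product)
  with assms have "pochhammer (\<alpha> + 1) k \<noteq> 0" by auto
  then show "pochhammer (- real n) k * pochhammer (real n + \<alpha> + \<beta> + 1) k *
        pochhammer (\<alpha> + 1 + real k) (n - k) * pochhammer (- M + real k) (n - k) / fact k *
        pochhammer (- x) k =
      pochhammer (\<alpha> + 1) n *
        (pochhammer (- real n) k * pochhammer (real n + \<alpha> + \<beta> + 1) k * pochhammer (- x) k /
            (pochhammer (\<alpha> + 1) k * fact k) * pochhammer (- M + real k) (n - k))"
    by (simp add: * divide_simps)
qed

lemma hahn_R_0 [simp]: "hahn_R 0 \<alpha> \<beta> M x = 1"
  by (simp add: hahn_R_def)

lemma hahn_R_lowering:
  "hahn_R (Suc n) \<alpha> \<beta> M (x + 1) - hahn_R (Suc n) \<alpha> \<beta> M x =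
     real (Suc n) * (real n + \<alpha> + \<beta> + 2) * hahn_R n (\<alpha> + 1) (\<beta> + 1) (M - 1) x"
proof -
  define c where "c k = pochhammer (- real (Suc n)) k * pochhammer (real (Suc n) + \<alpha> + \<beta> + 1) k *
        pochhammer (\<alpha> + 1 + real k) (Suc n - k) * pochhammer (- M + real k) (Suc n - k) / fact k" for k
  have diff: "pochhammer (- (x + 1)) (Suc k) - pochhammer (- x) (Suc k) =
      - real (Suc k) * pochhammer (- x) k" for k
  proof -
    have "pochhammer (- (x + 1)) (Suc k) = - (x + 1) * pochhammer (- x) k"
      by (simp add: pochhammer_rec)
    then show ?thesis by (simp add: pochhammer_Suc algebra_simps)
  qed
  have "hahn_R (Suc n) \<alpha> \<beta> M (x + 1) - hahn_R (Suc n) \<alpha> \<beta> M x =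
      (\<Sum>k\<le>Suc n. c k * (pochhammer (- (x + 1)) k - pochhammer (- x) k))"
    unfolding hahn_R_def c_def by (simp only: sum_subtractf right_diff_distrib)
  also have "\<dots> = (\<Sum>k\<le>n. c (Suc k) * (- real (Suc k) * pochhammer (- x) k))"
    unfolding sum.atMost_Suc_shift diff by simp
  also have "\<dots> = real (Suc n) * (real n + \<alpha> + \<beta> + 2) * hahn_R n (\<alpha> + 1) (\<beta> + 1) (M - 1) x"
    unfolding hahn_R_def sum_distrib_left
  proof (rule sum.cong[OF refl])
    fix k
    have 1: "pochhammer (- real (Suc n)) (Suc k) = - real (Suc n) * pochhammer (- real n) k"
      by (simp add: pochhammer_rec)
    have 2: "pochhammer (real (Suc n) + \<alpha> + \<beta> + 1) (Suc k) =
        (real n + \<alpha> + \<beta> + 2) * pochhammer (real n + (\<alpha> + 1) + (\<beta> + 1) + 1) k"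
      by (simp add: pochhammer_rec algebra_simps)
    have 3: "\<alpha> + 1 + real (Suc k) = (\<alpha> + 1) + 1 + real k" "- M + real (Suc k) = - (M - 1) + real k"
      by simp_all
    have 4: "(fact (Suc k) :: real) = real (Suc k) * fact k" by simp
    have alg: "(a * b) * (c * d) * p * q / (r * f) * (- r * z) = - a * c * (b * d * p * q / f * z)"
      if "r \<noteq> 0" for a b c d p q r f z :: real
      using that by simp
    show "c (Suc k) * (- real (Suc k) * pochhammer (- x) k) =
       real (Suc n) * (real n + \<alpha> + \<beta> + 2) *
       (pochhammer (- real n) k * pochhammer (real n + (\<alpha> + 1) + (\<beta> + 1) + 1) k *
        pochhammer (\<alpha> + 1 + 1 + real k) (n - k) * pochhammer (- (M - 1) + real k) (n - k) / fact k *
        pochhammer (- x) k)"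
      unfolding c_def 1 2 3 4 diff_Suc_Suc by (subst alg) simp_all
  qed
  finally show ?thesis .
qed

text \<open>
  The right-hand side is, up to a constant, the adjoint of the forward difference with respect to the
  Hahn weights, applied to \<open>R\<^sub>n\<close> with shifted parameters. It maps \<open>(-x)\<^sub>k\<close> to a combination of \<open>(-x)\<^sub>k\<^sub>+\<^sub>1\<close> and \<open>(-x)\<^sub>k\<close>,
  so coefficients in this basis can be compared.
\<close>

lemma hahn_R_raising:
  "hahn_R (Suc n) \<alpha> \<beta> M x =
     x * (\<beta> + M + 1 - x) * hahn_R n (\<alpha> + 1) (\<beta> + 1) (M - 1) (x - 1) -
     (\<alpha> + 1 + x) * (M - x) * hahn_R n (\<alpha> + 1) (\<beta> + 1) (M - 1) x"
proof -
  \<comment> \<open>\<open>c\<close> and \<open>c'\<close> are the coefficients of the polynomials on the left and the right in the basis \<open>(-x)\<^sub>k\<close>.\<close>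
  define c where "c k = pochhammer (- real (Suc n)) k * pochhammer (real (Suc n) + \<alpha> + \<beta> + 1) k *
        pochhammer (\<alpha> + 1 + real k) (Suc n - k) * pochhammer (- M + real k) (Suc n - k) / fact k" for k
  define c' where "c' k = pochhammer (- real n) k * pochhammer (real n + (\<alpha> + 1) + (\<beta> + 1) + 1) k *
        pochhammer (\<alpha> + 1 + 1 + real k) (n - k) * pochhammer (- (M - 1) + real k) (n - k) / fact k" for k
  define p where "p = pochhammer (- x)"
  have basis: "x * (\<beta> + M + 1 - x) * pochhammer (- (x - 1)) k - (\<alpha> + 1 + x) * (M - x) * p k =
      - (\<alpha> + \<beta> + 2 + real k) * p (Suc k) - (M - real k) * (\<alpha> + 1 + real k) * p k" for k
  proof -
    have *: "x * pochhammer (- (x - 1)) k = - p (Suc k)" by (simp add: p_def pochhammer_rec algebra_simps)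
    have **: "p (Suc k) = (real k - x) * p k" by (simp add: p_def pochhammer_Suc)
    have "x * (\<beta> + M + 1 - x) * pochhammer (- (x - 1)) k =
        (\<beta> + M + 1 - x) * (x * pochhammer (- (x - 1)) k)" by simp
    then show ?thesis unfolding * ** by (simp add: algebra_simps)
  qed
  \<comment> \<open>\<open>(-n)\<^sub>k\<close> vanishes for \<open>k > n\<close>, so the sum may be extended to \<open>Suc n\<close>.\<close>
  have c'_zero: "c' (Suc n) = 0"
    by (simp add: c'_def pochhammer_of_nat_eq_0_lemma)
  have coeff_0: "c 0 = - M * (\<alpha> + 1) * c' 0"
    by (simp add: c_def c'_def pochhammer_rec algebra_simps)
  have coeff_Suc: "c (Suc k) = - (\<alpha> + \<beta> + 2 + real k) * c' k -
      (M - real (Suc k)) * (\<alpha> + 1 + real (Suc k)) * c' (Suc k)" if "k \<le> n" for k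
  proof -
    define P where "P = pochhammer (- real n) k * pochhammer (real n + (\<alpha> + 1) + (\<beta> + 1) + 1) k *
       pochhammer (\<alpha> + 1 + 1 + real k) (n - k) * pochhammer (- (M - 1) + real k) (n - k) / fact (Suc k)"
    have 1: "pochhammer (- real (Suc n)) (Suc k) = - real (Suc n) * pochhammer (- real n) k"
      by (simp add: pochhammer_rec)
    have 2: "pochhammer (real (Suc n) + \<alpha> + \<beta> + 1) (Suc k) =
        (real n + \<alpha> + \<beta> + 2) * pochhammer (real n + (\<alpha> + 1) + (\<beta> + 1) + 1) k"
      by (simp add: pochhammer_rec algebra_simps)
    have 3: "\<alpha> + 1 + real (Suc k) = (\<alpha> + 1) + 1 + real k" "- M + real (Suc k) = - (M - 1) + real k"
      by simp_all
    have cS: "c (Suc k) = - real (Suc n) * (real n + \<alpha> + \<beta> + 2) * P"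
      unfolding c_def P_def 1 2 3 diff_Suc_Suc by simp
    have ck: "c' k = real (Suc k) * P"
      unfolding c'_def P_def by (simp add: field_simps del: of_nat_Suc)
    have cS': "(M - real (Suc k)) * (\<alpha> + 1 + real (Suc k)) * c' (Suc k) =
       - (real k - real n) * (real n + \<alpha> + \<beta> + 3 + real k) * P"
    proof (cases "k = n")
      case True
      then show ?thesis using c'_zero by simp
    next
      case False
      with that obtain m where m: "n - k = Suc m" "n - Suc k = m"
        by (metis Suc_diff_Suc le_neq_implies_less)
      have a: "pochhammer (\<alpha> + 1 + 1 + real k) (n - k) =
          (\<alpha> + 1 + real (Suc k)) * pochhammer (\<alpha> + 1 + 1 + real (Suc k)) (n - Suc k)"
        unfolding m by (simp add: pochhammer_rec algebra_simps)
      have b: "pochhammer (- (M - 1) + real k) (n - k) =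
          - (M - real (Suc k)) * pochhammer (- (M - 1) + real (Suc k)) (n - Suc k)"
        unfolding m by (simp add: pochhammer_rec algebra_simps)
      show ?thesis
        unfolding c'_def P_def a b pochhammer_Suc by (simp add: algebra_simps)
    qed
    show ?thesis unfolding cS ck cS' by (simp add: algebra_simps)
  qed
  have R: "hahn_R n (\<alpha> + 1) (\<beta> + 1) (M - 1) y = (\<Sum>k\<le>n. c' k * pochhammer (- y) k)" for y
    by (simp add: hahn_R_def c'_def)
  have "x * (\<beta> + M + 1 - x) * hahn_R n (\<alpha> + 1) (\<beta> + 1) (M - 1) (x - 1) -
     (\<alpha> + 1 + x) * (M - x) * hahn_R n (\<alpha> + 1) (\<beta> + 1) (M - 1) x =
     (\<Sum>k\<le>n. c' k * (x * (\<beta> + M + 1 - x) * pochhammer (- (x - 1)) k - (\<alpha> + 1 + x) * (M - x) * p k))"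
    unfolding R p_def sum_distrib_left sum_subtractf[symmetric]
    by (rule sum.cong) (simp_all add: algebra_simps)
  also have "\<dots> = (\<Sum>k\<le>n. - (\<alpha> + \<beta> + 2 + real k) * c' k * p (Suc k)) +
      (\<Sum>k\<le>n. - (M - real k) * (\<alpha> + 1 + real k) * c' k * p k)"
    unfolding basis sum.distrib[symmetric] by (rule sum.cong) (simp_all add: algebra_simps)
  also have "(\<Sum>k\<le>n. - (M - real k) * (\<alpha> + 1 + real k) * c' k * p k) =
      (\<Sum>k\<le>Suc n. - (M - real k) * (\<alpha> + 1 + real k) * c' k * p k)"
    by (simp add: c'_zero)
  also have "\<dots> = c 0 * p 0 +
      (\<Sum>k\<le>n. - (M - real (Suc k)) * (\<alpha> + 1 + real (Suc k)) * c' (Suc k) * p (Suc k))"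
    unfolding sum.atMost_Suc_shift by (simp add: coeff_0)
  also have "(\<Sum>k\<le>n. - (\<alpha> + \<beta> + 2 + real k) * c' k * p (Suc k)) + \<dots> =
      c 0 * p 0 + (\<Sum>k\<le>n. (- (\<alpha> + \<beta> + 2 + real k) * c' k -
        (M - real (Suc k)) * (\<alpha> + 1 + real (Suc k)) * c' (Suc k)) * p (Suc k))"
    unfolding add.left_commute[of _ "c 0 * p 0"] sum.distrib[symmetric]
    by (intro arg_cong2[of _ _ _ _ "(+)"] refl sum.cong) (simp_all add: algebra_simps)
  also have "\<dots> = c 0 * p 0 + (\<Sum>k\<le>n. c (Suc k) * p (Suc k))"
    using coeff_Suc by simp
  also have "\<dots> = (\<Sum>k\<le>Suc n. c k * p k)"
    unfolding sum.atMost_Suc_shift ..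
  finally show ?thesis unfolding hahn_R_def c_def p_def by simp
qed

lemma hahn_R_difference_equation:
  "(x + \<alpha> + 1) * (M - x) * (hahn_R n \<alpha> \<beta> M (x + 1) - hahn_R n \<alpha> \<beta> M x) +
   x * (M - x + \<beta> + 1) * (hahn_R n \<alpha> \<beta> M (x - 1) - hahn_R n \<alpha> \<beta> M x) =
   - real n * (real n + \<alpha> + \<beta> + 1) * hahn_R n \<alpha> \<beta> M x"
proof (cases n)
  case (Suc m)
  show ?thesis
    using hahn_R_lowering[of m \<alpha> \<beta> M x] hahn_R_lowering[of m \<alpha> \<beta> M "x - 1"]
      hahn_R_raising[of m \<alpha> \<beta> M x]
    unfolding Suc by (simp, algebra)
qed simp

text \<open>
  Distribute \<open>M\<close> particles over two sites, \<open>x\<close> on the first and \<open>M - x\<close> on the second. Then \<open>R\<^sub>n\<close>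
  is mapped to a multiple of itself by removing a particle (with rates equal to the occupation
  numbers) and by adding one (with the rates of the second lemma below). The first identity holds for
  each term of the sum separately; the second only after neighbouring terms are combined.
\<close>

lemma hahn_R_remove_one:
  "x * hahn_R n \<alpha> \<beta> (M - 1) (x - 1) + (M - x) * hahn_R n \<alpha> \<beta> (M - 1) x =
   (M - real n) * hahn_R n \<alpha> \<beta> M x"
  unfolding hahn_R_def sum_distrib_left sum.distrib[symmetric]
proof (rule sum.cong[OF refl])
  fix k assume "k \<in> {..n}"
  define m where "m = n - k"
  have n: "n = k + m" using \<open>k \<in> _\<close> by (simp add: m_def)
  have "x * pochhammer (- (x - 1)) k = - ((real k - x) * pochhammer (- x) k)"
    using pochhammer_Suc[of "- x" k] pochhammer_rec[of "- x" k] by (simp add: algebra_simps)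
  moreover have "(M - real k) * pochhammer (- (M - 1) + real k) m = (M - real n) * pochhammer (- M + real k) m"
    using pochhammer_Suc[of "- M + real k" m] pochhammer_rec[of "- M + real k" m]
    by (simp add: n algebra_simps)
  ultimately show "x * (pochhammer (- real n) k * pochhammer (real n + \<alpha> + \<beta> + 1) k *
           pochhammer (\<alpha> + 1 + real k) (n - k) * pochhammer (- (M - 1) + real k) (n - k) / fact k *
           pochhammer (- (x - 1)) k) +
      (M - x) * (pochhammer (- real n) k * pochhammer (real n + \<alpha> + \<beta> + 1) k *
           pochhammer (\<alpha> + 1 + real k) (n - k) * pochhammer (- (M - 1) + real k) (n - k) / fact k *
           pochhammer (- x) k) =
      (M - real n) * (pochhammer (- real n) k * pochhammer (real n + \<alpha> + \<beta> + 1) k *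
           pochhammer (\<alpha> + 1 + real k) (n - k) * pochhammer (- M + real k) (n - k) / fact k *
           pochhammer (- x) k)"
    unfolding m_def[symmetric] divide_inverse by algebra
qed

lemma hahn_R_add_one:
  "(x + \<alpha> + 1) * hahn_R n \<alpha> \<beta> (M + 1) (x + 1) + (M - x + \<beta> + 1) * hahn_R n \<alpha> \<beta> (M + 1) x =
   (M + real n + \<alpha> + \<beta> + 2) * hahn_R n \<alpha> \<beta> M x"
proof -
  define e where "e k = pochhammer (- real n) k * pochhammer (real n + \<alpha> + \<beta> + 1) k *
        pochhammer (\<alpha> + 1 + real k) (n - k) / fact k" for k
  define q where "q M k = pochhammer (- M + real k) (n - k)" for M k
  define p where "p = pochhammer (- x)"
  have R: "hahn_R n \<alpha> \<beta> M' y = (\<Sum>k\<le>n. e k * q M' k * pochhammer (- y) k)" for M' y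
    by (simp add: hahn_R_def e_def q_def)
  have basis: "(x + \<alpha> + 1) * pochhammer (- (x + 1)) k + (M - x + \<beta> + 1) * p k =
      (M + \<alpha> + \<beta> + 2 + real k) * p k - real k * (\<alpha> + real k) * p (k - 1)" for k
  proof (cases k)
    case (Suc j)
    have 1: "pochhammer (- (x + 1)) k = - (x + 1) * p j"
      by (simp add: Suc p_def pochhammer_rec)
    have 2: "p k = (real j - x) * p j"
      by (simp add: Suc p_def pochhammer_Suc)
    show ?thesis unfolding 1 2 by (simp add: Suc algebra_simps)
  qed (simp add: p_def)
  have eS: "(real k + 1) * (\<alpha> + real k + 1) * e (Suc k) =
      (real k - real n) * (real n + \<alpha> + \<beta> + 1 + real k) * e k" if "k < n" for k
  proof -
    obtain m where m: "n - k = Suc m" "n - Suc k = m" using Suc_diff_Suc[OF \<open>k < n\<close>] by metis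
    have a: "pochhammer (\<alpha> + 1 + real k) (n - k) =
        (\<alpha> + real k + 1) * pochhammer (\<alpha> + 1 + real (Suc k)) (n - Suc k)"
      unfolding m by (simp add: pochhammer_rec algebra_simps)
    have alg: "r * u * (a * b * (c * d) * p / (r * f)) = b * d * (a * c * (u * p) / f)" if "r \<noteq> 0"
      for a b c d p r f u :: real using that by simp
    have f: "fact (Suc k) = (real k + 1) * fact k" by simp
    show ?thesis unfolding e_def a pochhammer_Suc f
      by (subst alg) (simp_all add: algebra_simps)
  qed
  have top: "q (M + 1) n = q M n" by (simp add: q_def)
  have coeff: "(M + \<alpha> + \<beta> + 2 + real k) * (e k * q (M + 1) k) -
      (real k + 1) * (\<alpha> + real k + 1) * e (Suc k) * q (M + 1) (Suc k) =
      (M + real n + \<alpha> + \<beta> + 2) * (e k * q M k)" if "k < n" for k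
  proof -
    obtain m where m: "n - k = Suc m" "n - Suc k = m" using Suc_diff_Suc[OF \<open>k < n\<close>] by metis
    then have nk: "real n = real k + real m + 1" using that by linarith
    define t where "t = pochhammer (- M + real k) m"
    have 1: "q (M + 1) k = (- M - 1 + real k) * t"
      unfolding q_def m t_def by (simp add: pochhammer_rec algebra_simps)
    have 2: "q (M + 1) (Suc k) = t" unfolding q_def m t_def by (simp add: algebra_simps)
    have 3: "q M k = t * (- M + real n - 1)"
      unfolding q_def m t_def by (simp add: pochhammer_Suc nk algebra_simps)
    show ?thesis unfolding eS[OF that] 1 2 3 by (simp add: algebra_simps)
  qed
  have "(x + \<alpha> + 1) * hahn_R n \<alpha> \<beta> (M + 1) (x + 1) + (M - x + \<beta> + 1) * hahn_R n \<alpha> \<beta> (M + 1) x =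
     (\<Sum>k\<le>n. e k * q (M + 1) k * ((x + \<alpha> + 1) * pochhammer (- (x + 1)) k + (M - x + \<beta> + 1) * p k))"
    unfolding R p_def sum_distrib_left sum.distrib[symmetric]
    by (rule sum.cong) (simp_all add: algebra_simps)
  also have "\<dots> = (\<Sum>k\<le>n. (M + \<alpha> + \<beta> + 2 + real k) * (e k * q (M + 1) k) * p k) -
      (\<Sum>k\<le>n. real k * (\<alpha> + real k) * e k * q (M + 1) k * p (k - 1))"
    unfolding basis sum_subtractf[symmetric] by (rule sum.cong) (simp_all add: algebra_simps)
  also have "(\<Sum>k\<le>n. real k * (\<alpha> + real k) * e k * q (M + 1) k * p (k - 1)) =
      (\<Sum>k<n. (real k + 1) * (\<alpha> + real k + 1) * e (Suc k) * q (M + 1) (Suc k) * p k)"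
    by (simp add: sum.atMost_shift algebra_simps)
  also have "(\<Sum>k\<le>n. (M + \<alpha> + \<beta> + 2 + real k) * (e k * q (M + 1) k) * p k) =
      (\<Sum>k<n. (M + \<alpha> + \<beta> + 2 + real k) * (e k * q (M + 1) k) * p k) +
      (M + real n + \<alpha> + \<beta> + 2) * (e n * q M n) * p n"
    unfolding lessThan_Suc_atMost[symmetric] sum.lessThan_Suc top by (simp add: algebra_simps)
  also have "\<dots> - (\<Sum>k<n. (real k + 1) * (\<alpha> + real k + 1) * e (Suc k) * q (M + 1) (Suc k) * p k) =
      (\<Sum>k<n. ((M + \<alpha> + \<beta> + 2 + real k) * (e k * q (M + 1) k) -
        (real k + 1) * (\<alpha> + real k + 1) * e (Suc k) * q (M + 1) (Suc k)) * p k) +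
      (M + real n + \<alpha> + \<beta> + 2) * (e n * q M n) * p n"
    by (simp add: sum_subtractf left_diff_distrib)
  also have "\<dots> = (\<Sum>k<n. (M + real n + \<alpha> + \<beta> + 2) * (e k * q M k) * p k) +
      (M + real n + \<alpha> + \<beta> + 2) * (e n * q M n) * p n"
    using coeff by simp
  also have "\<dots> = (M + real n + \<alpha> + \<beta> + 2) * hahn_R n \<alpha> \<beta> M x"
    unfolding R p_def lessThan_Suc_atMost[symmetric] sum_distrib_left by (simp add: algebra_simps)
  finally show ?thesis .
qed

section \<open>Orthogonality in one variable\<close>

lemma shifted_binom_0 [simp]: "shifted_binom 0 y = 1"
  by (simp add: shifted_binom_def)

lemma shifted_binom_raise_parameter:
  "(y + 1) * shifted_binom k (y + 1) = (y + 1 + real k) * shifted_binom k y"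
  using pochhammer_Suc[of "y + 1" k] pochhammer_rec[of "y + 1" k]
  by (simp add: shifted_binom_def algebra_simps flip: add_divide_distrib)

lemma shifted_binom_Suc:
  "real (Suc k) * shifted_binom (Suc k) y = (y + 1) * shifted_binom k (y + 1)"
  using pochhammer_rec[of "y + 1" k]
  by (simp add: shifted_binom_def add.assoc del: of_nat_Suc)

lemma shifted_binom_Vandermonde:
  "(\<Sum>x\<le>M. shifted_binom x \<alpha> * shifted_binom (M - x) \<beta>) = shifted_binom M (\<alpha> + \<beta> + 1)"
proof -
  have "shifted_binom M (\<alpha> + \<beta> + 1) = pochhammer ((\<alpha> + 1) + (\<beta> + 1)) M / fact M"
    by (simp add: shifted_binom_def algebra_simps)
  also have "\<dots> = (\<Sum>x\<le>M. real (M choose x) * pochhammer (\<alpha> + 1) x * pochhammer (\<beta> + 1) (M - x) / fact M)"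
    unfolding pochhammer_binomial_sum by (simp add: sum_divide_distrib)
  also have "\<dots> = (\<Sum>x\<le>M. shifted_binom x \<alpha> * shifted_binom (M - x) \<beta>)"
    by (rule sum.cong) (simp_all add: shifted_binom_def binomial_fact)
  finally show ?thesis ..
qed

text \<open>The (possibly indefinite) inner product with the Hahn weights on \<open>{0..M}\<close>.\<close>

definition hahn_ip :: "real \<Rightarrow> real \<Rightarrow> nat \<Rightarrow> (real \<Rightarrow> real) \<Rightarrow> (real \<Rightarrow> real) \<Rightarrow> real" where
  "hahn_ip \<alpha> \<beta> M f g =
     (\<Sum>x\<le>M. shifted_binom x \<alpha> * shifted_binom (M - x) \<beta> * f (real x) * g (real x))"

lemma hahn_ip_commute: "hahn_ip \<alpha> \<beta> M f g = hahn_ip \<alpha> \<beta> M g f"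
  by (simp add: hahn_ip_def mult_ac)

text \<open>
  Summation by parts. It rests on two expressions for the shifted weight: with \<open>w\<close> the weight for
  \<open>\<alpha>, \<beta>, M + 1\<close> and \<open>W\<close> that for \<open>\<alpha> + 1, \<beta> + 1, M\<close>, times \<open>(\<alpha> + 1)(\<beta> + 1)\<close>, one has
  \<open>W(x) = w(x)(\<alpha> + 1 + x)(M + 1 - x) = w(x + 1)(x + 1)(\<beta> + 1 + M - x)\<close>.
\<close>

lemma hahn_ip_adjoint:
  "hahn_ip \<alpha> \<beta> (Suc M) f
      (\<lambda>x. x * (\<beta> + real (Suc M) + 1 - x) * g (x - 1) - (\<alpha> + 1 + x) * (real (Suc M) - x) * g x) =
   (\<alpha> + 1) * (\<beta> + 1) * hahn_ip (\<alpha> + 1) (\<beta> + 1) M (\<lambda>x. f (x + 1) - f x) g"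
proof -
  define w where "w x = shifted_binom x \<alpha> * shifted_binom (Suc M - x) \<beta>" for x
  define W where "W x = (\<alpha> + 1) * (\<beta> + 1) * (shifted_binom x (\<alpha> + 1) * shifted_binom (M - x) (\<beta> + 1))" for x
  have W: "W x = w x * ((\<alpha> + 1 + real x) * (real (Suc M) - real x))"
          "W x = w (Suc x) * (real (Suc x) * (\<beta> + real (Suc M) + 1 - real (Suc x)))" if "x \<le> M" for x
  proof -
    from that have M: "Suc M - x = Suc (M - x)" "real (M - x) = real M - real x"
      by (simp_all add: of_nat_diff)
    have 1: "(\<alpha> + 1 + real x) * shifted_binom x \<alpha> = (\<alpha> + 1) * shifted_binom x (\<alpha> + 1)"
        "real (Suc x) * shifted_binom (Suc x) \<alpha> = (\<alpha> + 1) * shifted_binom x (\<alpha> + 1)"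
      by (simp_all only: shifted_binom_raise_parameter shifted_binom_Suc)
    have 2: "(\<beta> + 1 + (real M - real x)) * shifted_binom (M - x) \<beta> = (\<beta> + 1) * shifted_binom (M - x) (\<beta> + 1)"
        "(real M - real x + 1) * shifted_binom (Suc M - x) \<beta> = (\<beta> + 1) * shifted_binom (M - x) (\<beta> + 1)"
      using shifted_binom_raise_parameter[of \<beta> "M - x"] shifted_binom_Suc[of "M - x" \<beta>]
      unfolding M by (simp_all add: M add.commute)
    have "W x = ((\<alpha> + 1 + real x) * shifted_binom x \<alpha>) * ((real M - real x + 1) * shifted_binom (Suc M - x) \<beta>)"
      unfolding 1 2 W_def by simp
    then show "W x = w x * ((\<alpha> + 1 + real x) * (real (Suc M) - real x))"
      by (simp add: w_def)
    have "W x = (real (Suc x) * shifted_binom (Suc x) \<alpha>) * ((\<beta> + 1 + (real M - real x)) * shifted_binom (M - x) \<beta>)"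
      unfolding 1 2 W_def by simp
    then show "W x = w (Suc x) * (real (Suc x) * (\<beta> + real (Suc M) + 1 - real (Suc x)))"
      by (simp add: w_def algebra_simps)
  qed
  have "hahn_ip \<alpha> \<beta> (Suc M) f
      (\<lambda>x. x * (\<beta> + real (Suc M) + 1 - x) * g (x - 1) - (\<alpha> + 1 + x) * (real (Suc M) - x) * g x) =
     (\<Sum>x\<le>Suc M. w x * (real x * (\<beta> + real (Suc M) + 1 - real x)) * (f (real x) * g (real x - 1))) -
     (\<Sum>x\<le>Suc M. w x * ((\<alpha> + 1 + real x) * (real (Suc M) - real x)) * (f (real x) * g (real x)))"
    unfolding hahn_ip_def w_def sum_subtractf[symmetric]
    by (rule sum.cong) (simp_all add: right_diff_distrib mult_ac)
  also have "(\<Sum>x\<le>Suc M. w x * (real x * (\<beta> + real (Suc M) + 1 - real x)) * (f (real x) * g (real x - 1))) =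
     (\<Sum>x\<le>M. W x * (f (real x + 1) * g (real x)))"
    unfolding sum.atMost_Suc_shift using W(2) by (simp add: add.commute)
  also have "(\<Sum>x\<le>Suc M. w x * ((\<alpha> + 1 + real x) * (real (Suc M) - real x)) * (f (real x) * g (real x))) =
     (\<Sum>x\<le>M. W x * (f (real x) * g (real x)))"
    using W(1) by simp
  also have "(\<Sum>x\<le>M. W x * (f (real x + 1) * g (real x))) - \<dots> =
     (\<alpha> + 1) * (\<beta> + 1) * hahn_ip (\<alpha> + 1) (\<beta> + 1) M (\<lambda>x. f (x + 1) - f x) g"
    unfolding hahn_ip_def W_def sum_subtractf[symmetric] sum_distrib_left
    by (rule sum.cong) (simp_all add: algebra_simps)
  finally show ?thesis .
qed

lemma hahn_ip_hahn_R_Suc: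
  "hahn_ip \<alpha> \<beta> (Suc M) f (hahn_R (Suc m) \<alpha> \<beta> (real (Suc M))) =
   (\<alpha> + 1) * (\<beta> + 1) * hahn_ip (\<alpha> + 1) (\<beta> + 1) M (\<lambda>x. f (x + 1) - f x)
     (hahn_R m (\<alpha> + 1) (\<beta> + 1) (real M))"
proof -
  have "hahn_R (Suc m) \<alpha> \<beta> (real (Suc M)) = (\<lambda>x. x * (\<beta> + real (Suc M) + 1 - x) *
      hahn_R m (\<alpha> + 1) (\<beta> + 1) (real M) (x - 1) -
      (\<alpha> + 1 + x) * (real (Suc M) - x) * hahn_R m (\<alpha> + 1) (\<beta> + 1) (real M) x)"
    using hahn_R_raising[of m \<alpha> \<beta> "real (Suc M)"] by (simp add: fun_eq_iff)
  then show ?thesis by (simp only: hahn_ip_adjoint)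
qed

text \<open>
  For \<open>n > M\<close> the value is zero even if \<open>n = m\<close>, as \<open>R\<^sub>n\<close> then vanishes on \<open>{0..M}\<close>.
\<close>

lemma hahn_R_orthogonality:
  "hahn_ip \<alpha> \<beta> M (hahn_R n \<alpha> \<beta> (real M)) (hahn_R m \<alpha> \<beta> (real M)) =
   (if n = m \<and> n \<le> M then
      pochhammer (\<alpha> + 1) n * pochhammer (\<beta> + 1) n * fact n * pochhammer (real n + \<alpha> + \<beta> + 1) n *
      shifted_binom (M - n) (\<alpha> + \<beta> + 2 * real n + 1)
    else 0)"
proof (induction n arbitrary: m \<alpha> \<beta> M)
  have at_0: "hahn_R (Suc k) \<alpha> \<beta> 0 0 = 0" for k \<alpha> \<beta>
    using hahn_R_raising[of k \<alpha> \<beta> 0 0] by simp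
  have const: "hahn_ip \<alpha> \<beta> M (hahn_R 0 \<alpha> \<beta> (real M)) (hahn_R (Suc k) \<alpha> \<beta> (real M)) = 0" for k \<alpha> \<beta> M
  proof (cases M)
    case (Suc M')
    then show ?thesis
      unfolding Suc hahn_ip_hahn_R_Suc by (simp add: hahn_ip_def)
  qed (simp add: hahn_ip_def at_0)
  {
    case 0
    show ?case
    proof (cases m)
      case 0
      then show ?thesis
        using shifted_binom_Vandermonde[of \<alpha> M \<beta>] by (simp add: hahn_ip_def)
    next
      case (Suc k)
      then show ?thesis using const[of \<alpha> \<beta> M k] by (simp del: hahn_R_0)
    qed
  next
    case (Suc n)
    show ?case
    proof (cases m)
      case 0
      then show ?thesis using const[of \<alpha> \<beta> M n] by (subst hahn_ip_commute) (simp del: hahn_R_0)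
    next
      case m: (Suc m')
      show ?thesis
      proof (cases M)
        case 0
        then show ?thesis by (simp add: hahn_ip_def m at_0)
      next
        case M: (Suc M')
        have low: "(\<lambda>x. hahn_R (Suc n) \<alpha> \<beta> (real (Suc M')) (x + 1) - hahn_R (Suc n) \<alpha> \<beta> (real (Suc M')) x) =
           (\<lambda>x. real (Suc n) * (real n + \<alpha> + \<beta> + 2) * hahn_R n (\<alpha> + 1) (\<beta> + 1) (real M') x)"
          unfolding hahn_R_lowering by simp
        have scale: "hahn_ip a b K (\<lambda>x. c * f x) g = c * hahn_ip a b K f g" for a b c K f g
          by (simp add: hahn_ip_def sum_distrib_left mult_ac)
        have "hahn_ip \<alpha> \<beta> M (hahn_R (Suc n) \<alpha> \<beta> (real M)) (hahn_R m \<alpha> \<beta> (real M)) =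
          (\<alpha> + 1) * (\<beta> + 1) * (real (Suc n) * (real n + \<alpha> + \<beta> + 2) *
            hahn_ip (\<alpha> + 1) (\<beta> + 1) M' (hahn_R n (\<alpha> + 1) (\<beta> + 1) (real M'))
              (hahn_R m' (\<alpha> + 1) (\<beta> + 1) (real M')))"
          unfolding M m hahn_ip_hahn_R_Suc low scale ..
        also have "\<dots> = (if Suc n = m \<and> Suc n \<le> M then
          (\<alpha> + 1) * (\<beta> + 1) * (real (Suc n) * (real n + \<alpha> + \<beta> + 2) *
          (pochhammer (\<alpha> + 1 + 1) n * pochhammer (\<beta> + 1 + 1) n * fact n *
           pochhammer (real n + (\<alpha> + 1) + (\<beta> + 1) + 1) n *
           shifted_binom (M' - n) ((\<alpha> + 1) + (\<beta> + 1) + 2 * real n + 1))) else 0)"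
          unfolding Suc.IH by (simp add: M m)
        also have "(\<alpha> + 1) * (\<beta> + 1) * (real (Suc n) * (real n + \<alpha> + \<beta> + 2) *
          (pochhammer (\<alpha> + 1 + 1) n * pochhammer (\<beta> + 1 + 1) n * fact n *
           pochhammer (real n + (\<alpha> + 1) + (\<beta> + 1) + 1) n *
           shifted_binom (M' - n) ((\<alpha> + 1) + (\<beta> + 1) + 2 * real n + 1))) =
          pochhammer (\<alpha> + 1) (Suc n) * pochhammer (\<beta> + 1) (Suc n) * fact (Suc n) *
          pochhammer (real (Suc n) + \<alpha> + \<beta> + 1) (Suc n) *
          shifted_binom (M - Suc n) (\<alpha> + \<beta> + 2 * real (Suc n) + 1)"
        proof -
          have "real n + (\<alpha> + 1) + (\<beta> + 1) + 1 = real (Suc n) + \<alpha> + \<beta> + 1 + 1"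
            "real n + \<alpha> + \<beta> + 2 = real (Suc n) + \<alpha> + \<beta> + 1"
            "(\<alpha> + 1) + (\<beta> + 1) + 2 * real n + 1 = \<alpha> + \<beta> + 2 * real (Suc n) + 1"
            by simp_all
          then show ?thesis
            unfolding pochhammer_rec fact_Suc M diff_Suc_Suc by (simp only: mult_ac)
        qed
        finally show ?thesis .
      qed
    qed
  }
qed

section \<open>Splitting off the last variable\<close>

text \<open>The lattice points of the \<open>N\<close>-fold standard simplex; as in \<open>V_set\<close>, they vanish off \<open>{1..d}\<close>.\<close>

definition simplex :: "nat \<Rightarrow> nat \<Rightarrow> (nat \<Rightarrow> nat) set" where
  "simplex d N = {x. (\<forall>i. i \<notin> {1..d} \<longrightarrow> x i = 0) \<and> (\<Sum>i=1..d. x i) \<le> N}"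

lemma simplex_0: "simplex 0 N = {\<lambda>_. 0}"
  by (auto simp: simplex_def)

lemma bij_betw_simplex_Suc:
  "bij_betw (\<lambda>(x, y). x(Suc d := y)) (SIGMA x:simplex d N. {..N - (\<Sum>i=1..d. x i)}) (simplex (Suc d) N)"
proof (rule bij_betw_byWitness[where f' = "\<lambda>x. (x(Suc d := 0), x (Suc d))"])
  have restr: "(\<Sum>i=1..d. (x(Suc d := y)) i) = (\<Sum>i=1..d. x i)" for x :: "nat \<Rightarrow> nat" and y
    by (rule sum.cong) auto
  show "(\<lambda>(x, y). x(Suc d := y)) ` (SIGMA x:simplex d N. {..N - (\<Sum>i=1..d. x i)}) \<subseteq> simplex (Suc d) N"
    using restr by (auto simp: simplex_def)
  show "(\<lambda>x. (x(Suc d := 0), x (Suc d))) ` simplex (Suc d) N \<subseteq> (SIGMA x:simplex d N. {..N - (\<Sum>i=1..d. x i)})"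
    using restr by (auto simp: simplex_def)
qed (auto simp: simplex_def fun_eq_iff)

lemma finite_simplex: "finite (simplex d N)"
proof (induction d)
  case (Suc d)
  then show ?case
    using bij_betw_finite[OF bij_betw_simplex_Suc[of d N]] by simp
qed (simp add: simplex_0)

lemma sum_simplex_Suc:
  fixes F :: "(nat \<Rightarrow> nat) \<Rightarrow> real"
  shows "(\<Sum>x\<in>simplex (Suc d) N. F x) =
    (\<Sum>x\<in>simplex d N. \<Sum>y\<le>N - (\<Sum>i=1..d. x i). F (x(Suc d := y)))"
  unfolding sum.reindex_bij_betw[OF bij_betw_simplex_Suc, symmetric]
  by (subst sum.Sigma) (auto simp: finite_simplex case_prod_beta intro: sum.cong)

text \<open>\<open>Q\<^sub>\<nu>\<close> without its constant factor. As a polynomial in \<open>N\<close>, it is defined for real \<open>N\<close>.\<close>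

definition multi_hahn_R :: "nat \<Rightarrow> real \<Rightarrow> (nat \<Rightarrow> real) \<Rightarrow> (nat \<Rightarrow> nat) \<Rightarrow> (nat \<Rightarrow> real) \<Rightarrow> real" where
  "multi_hahn_R d N \<sigma> \<nu> x =
     (\<Prod>j=1..d. hahn_R (\<nu> j) (\<sigma> j) (hahn_a d \<sigma> \<nu> j)
        (N - (\<Sum>i=1..<j. x i) - real (\<Sum>i=j+1..d. \<nu> i)) (x j))"

text \<open>
  The parameters of the \<open>d\<close>-variable problem that is left of the \<open>(d+1)\<close>-variable one when the last
  factor has degree \<open>n\<close>; entries beyond \<open>d + 1\<close> are irrelevant.
\<close>

definition merge_last :: "nat \<Rightarrow> nat \<Rightarrow> (nat \<Rightarrow> real) \<Rightarrow> nat \<Rightarrow> real" where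
  "merge_last d n \<sigma> = \<sigma>(Suc d := \<sigma> (Suc d) + \<sigma> (Suc (Suc d)) + 2 * real n + 1)"

lemma merge_last_le: "i \<le> d \<Longrightarrow> merge_last d n \<sigma> i = \<sigma> i"
  by (simp add: merge_last_def)

lemma sum_merge_last:
  "j \<le> d \<Longrightarrow> (\<Sum>i=Suc j..Suc d. merge_last d n \<sigma> i) = (\<Sum>i=Suc j..Suc (Suc d). \<sigma> i) + 2 * real n + 1"
  by (simp add: merge_last_def)

lemma hahn_a_Suc:
  assumes "j \<le> d"
  shows "hahn_a (Suc d) \<sigma> \<nu> j = hahn_a d (merge_last d (\<nu> (Suc d)) \<sigma>) \<nu> j"
  using assms sum_merge_last[OF assms, of "\<nu> (Suc d)" \<sigma>] by (simp add: hahn_a_def)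

lemma hahn_a_last: "hahn_a (Suc d) \<sigma> \<nu> (Suc d) = \<sigma> (Suc (Suc d))"
  by (simp add: hahn_a_def)

lemma multi_hahn_R_Suc:
  "multi_hahn_R (Suc d) N \<sigma> \<nu> x =
     hahn_R (\<nu> (Suc d)) (\<sigma> (Suc d)) (\<sigma> (Suc (Suc d))) (N - (\<Sum>i=1..d. x i)) (x (Suc d)) *
     multi_hahn_R d (N - real (\<nu> (Suc d))) (merge_last d (\<nu> (Suc d)) \<sigma>) \<nu> x"
proof -
  have "(\<Prod>j=1..d. hahn_R (\<nu> j) (\<sigma> j) (hahn_a (Suc d) \<sigma> \<nu> j)
        (N - (\<Sum>i=1..<j. x i) - real (\<Sum>i=j+1..Suc d. \<nu> i)) (x j)) =
     multi_hahn_R d (N - real (\<nu> (Suc d))) (merge_last d (\<nu> (Suc d)) \<sigma>) \<nu> x"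
    unfolding multi_hahn_R_def
    by (rule prod.cong) (simp_all add: hahn_a_Suc merge_last_le algebra_simps)
  then show ?thesis
    by (simp add: multi_hahn_R_def hahn_a_last atLeastLessThanSuc_atLeastAtMost)
qed

lemma multi_hahn_R_cong:
  "(\<And>i. i \<in> {1..d} \<Longrightarrow> x i = y i) \<Longrightarrow> multi_hahn_R d N \<sigma> \<nu> x = multi_hahn_R d N \<sigma> \<nu> y"
  unfolding multi_hahn_R_def
  by (intro prod.cong refl arg_cong2[of _ _ _ _ "hahn_R _ _ _"] arg_cong2[of _ _ _ _ "(-)"] sum.cong) auto

section \<open>Orthogonality on the simplex\<close>

text \<open>The squared norm of \<open>multi_hahn_R\<close>.\<close>

definition multi_hahn_R_norm :: "nat \<Rightarrow> nat \<Rightarrow> (nat \<Rightarrow> real) \<Rightarrow> (nat \<Rightarrow> nat) \<Rightarrow> real" where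
  "multi_hahn_R_norm d N \<sigma> \<nu> =
     shifted_binom (N - (\<Sum>i=1..d. \<nu> i)) ((\<Sum>m=1..d+1. \<sigma> m) + real d + 2 * real (\<Sum>i=1..d. \<nu> i)) *
     (\<Prod>j=1..d. pochhammer (\<sigma> j + 1) (\<nu> j) * pochhammer (hahn_a d \<sigma> \<nu> j + 1) (\<nu> j) * fact (\<nu> j) *
        pochhammer (real (\<nu> j) + \<sigma> j + hahn_a d \<sigma> \<nu> j + 1) (\<nu> j))"

lemma multi_hahn_R_norm_Suc:
  fixes d \<sigma> \<nu>
  defines "n \<equiv> \<nu> (Suc d)" and "\<alpha> \<equiv> \<sigma> (Suc d)" and "\<beta> \<equiv> \<sigma> (Suc (Suc d))"
  shows "multi_hahn_R_norm (Suc d) N \<sigma> \<nu> =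
     pochhammer (\<alpha> + 1) n * pochhammer (\<beta> + 1) n * fact n * pochhammer (real n + \<alpha> + \<beta> + 1) n *
     multi_hahn_R_norm d (N - n) (merge_last d n \<sigma>) \<nu>"
proof -
  have "(\<Prod>j=1..d. pochhammer (\<sigma> j + 1) (\<nu> j) * pochhammer (hahn_a (Suc d) \<sigma> \<nu> j + 1) (\<nu> j) * fact (\<nu> j) *
        pochhammer (real (\<nu> j) + \<sigma> j + hahn_a (Suc d) \<sigma> \<nu> j + 1) (\<nu> j)) =
     (\<Prod>j=1..d. pochhammer (merge_last d n \<sigma> j + 1) (\<nu> j) *
        pochhammer (hahn_a d (merge_last d n \<sigma>) \<nu> j + 1) (\<nu> j) * fact (\<nu> j) *
        pochhammer (real (\<nu> j) + merge_last d n \<sigma> j + hahn_a d (merge_last d n \<sigma>) \<nu> j + 1) (\<nu> j))"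
    unfolding n_def by (rule prod.cong) (simp_all add: hahn_a_Suc merge_last_le)
  moreover have "(\<Sum>m=1..d+1. merge_last d n \<sigma> m) = (\<Sum>m=1..Suc d+1. \<sigma> m) + 2 * real n + 1"
    using sum_merge_last[of 0 d n \<sigma>] by simp
  ultimately show ?thesis
    unfolding multi_hahn_R_norm_def
    by (simp add: n_def \<alpha>_def \<beta>_def hahn_a_last algebra_simps)
qed

text \<open>
  No assumption on \<open>\<sigma>\<close> is made. If \<open>\<nu>\<^sub>d \<noteq> \<mu>\<^sub>d\<close> the sum over \<open>x\<^sub>d\<close> vanishes; if they agree, both remaining
  products belong to the same merged parameters.
\<close>

lemma multi_hahn_R_orthogonality:
  assumes "(\<Sum>i=1..d. \<nu> i) \<le> N"
  shows "(\<Sum>x\<in>simplex d N. multi_hahn_R d (real N) \<sigma> \<nu> (vec_real x) *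
      multi_hahn_R d (real N) \<sigma> \<mu> (vec_real x) * hahn_weight d N \<sigma> x) =
    (if \<forall>i\<in>{1..d}. \<nu> i = \<mu> i then multi_hahn_R_norm d N \<sigma> \<nu> else 0)"
  using assms
proof (induction d arbitrary: N \<sigma>)
  case 0
  then show ?case
    by (simp add: simplex_0 multi_hahn_R_def multi_hahn_R_norm_def hahn_weight_def)
next
  case (Suc d)
  define n m \<alpha> \<beta> where "n = \<nu> (Suc d)" and "m = \<mu> (Suc d)" and "\<alpha> = \<sigma> (Suc d)" and "\<beta> = \<sigma> (Suc (Suc d))"
  define c where "c = pochhammer (\<alpha> + 1) n * pochhammer (\<beta> + 1) n * fact n * pochhammer (real n + \<alpha> + \<beta> + 1) n"
  define g where "g x = multi_hahn_R d (real N - real n) (merge_last d n \<sigma>) \<nu> (vec_real x) *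
     multi_hahn_R d (real N - real m) (merge_last d m \<sigma>) \<mu> (vec_real x)" for x
  define w where "w x = (\<Prod>i=1..d. shifted_binom (x i) (\<sigma> i))" for x :: "nat \<Rightarrow> nat"
  have inner: "(\<Sum>y\<le>N - (\<Sum>i=1..d. x i). multi_hahn_R (Suc d) (real N) \<sigma> \<nu> (vec_real (x(Suc d := y))) *
      multi_hahn_R (Suc d) (real N) \<sigma> \<mu> (vec_real (x(Suc d := y))) * hahn_weight (Suc d) N \<sigma> (x(Suc d := y))) =
     (if n = m \<and> n + (\<Sum>i=1..d. x i) \<le> N then
        c * (g x * (w x * shifted_binom (N - n - (\<Sum>i=1..d. x i)) (\<alpha> + \<beta> + 2 * real n + 1))) else 0)"
    if "x \<in> simplex d N" for x
  proof -
    define M where "M = N - (\<Sum>i=1..d. x i)"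
    have M: "real N - (\<Sum>i=1..d. real (x i)) = real M"
      using that by (simp add: M_def simplex_def of_nat_diff)
    have sum_eq: "(\<Sum>i=1..d. vec_real (x(Suc d := y)) i) = (\<Sum>i=1..d. real (x i))" for y
      by (rule sum.cong) (auto simp: vec_real_def)
    have R: "multi_hahn_R (Suc d) (real N) \<sigma> \<kappa> (vec_real (x(Suc d := y))) =
        hahn_R (\<kappa> (Suc d)) \<alpha> \<beta> (real M) (real y) *
        multi_hahn_R d (real N - real (\<kappa> (Suc d))) (merge_last d (\<kappa> (Suc d)) \<sigma>) \<kappa> (vec_real x)" for \<kappa> y
      unfolding multi_hahn_R_Suc sum_eq M \<alpha>_def \<beta>_def
      by (intro arg_cong2[of _ _ _ _ "(*)"] multi_hahn_R_cong) (simp_all add: vec_real_def)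
    have W: "hahn_weight (Suc d) N \<sigma> (x(Suc d := y)) =
        w x * (shifted_binom y \<alpha> * shifted_binom (M - y) \<beta>)" for y
      by (simp add: hahn_weight_def w_def M_def \<alpha>_def \<beta>_def)
    have "(\<Sum>y\<le>M. multi_hahn_R (Suc d) (real N) \<sigma> \<nu> (vec_real (x(Suc d := y))) *
        multi_hahn_R (Suc d) (real N) \<sigma> \<mu> (vec_real (x(Suc d := y))) * hahn_weight (Suc d) N \<sigma> (x(Suc d := y))) =
       g x * w x * hahn_ip \<alpha> \<beta> M (hahn_R n \<alpha> \<beta> (real M)) (hahn_R m \<alpha> \<beta> (real M))"
      unfolding R W hahn_ip_def sum_distrib_left g_def n_def m_def
      by (rule sum.cong) (simp_all only: mult_ac)
    also have "\<dots> = (if n = m \<and> n + (\<Sum>i=1..d. x i) \<le> N then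
        c * (g x * (w x * shifted_binom (N - n - (\<Sum>i=1..d. x i)) (\<alpha> + \<beta> + 2 * real n + 1))) else 0)"
    proof -
      have "n \<le> M \<longleftrightarrow> n + (\<Sum>i=1..d. x i) \<le> N" "M - n = N - n - (\<Sum>i=1..d. x i)"
        using that by (auto simp: M_def simplex_def)
      then show ?thesis unfolding hahn_R_orthogonality c_def by (cases "n = m") simp_all
    qed
    finally show ?thesis unfolding M_def .
  qed
  have "(\<Sum>x\<in>simplex (Suc d) N. multi_hahn_R (Suc d) (real N) \<sigma> \<nu> (vec_real x) *
      multi_hahn_R (Suc d) (real N) \<sigma> \<mu> (vec_real x) * hahn_weight (Suc d) N \<sigma> x) =
    (\<Sum>x\<in>simplex d N. if n = m \<and> n + (\<Sum>i=1..d. x i) \<le> N then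
        c * (g x * (w x * shifted_binom (N - n - (\<Sum>i=1..d. x i)) (\<alpha> + \<beta> + 2 * real n + 1))) else 0)"
    unfolding sum_simplex_Suc by (rule sum.cong[OF refl inner])
  also have "\<dots> = (if \<forall>i\<in>{1..Suc d}. \<nu> i = \<mu> i then multi_hahn_R_norm (Suc d) N \<sigma> \<nu> else 0)"
  proof (cases "n = m")
    case False
    then show ?thesis by (auto simp: n_def m_def)
  next
    case True
    have le: "n \<le> N" "(\<Sum>i=1..d. \<nu> i) \<le> N - n"
      using Suc.prems by (simp_all add: n_def)
    \<comment> \<open>Points with \<open>|x| > N - n\<close> contribute nothing, so the sum is over the smaller simplex.\<close>
    have "(\<Sum>x\<in>simplex d N. if n = m \<and> n + (\<Sum>i=1..d. x i) \<le> N then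
        c * (g x * (w x * shifted_binom (N - n - (\<Sum>i=1..d. x i)) (\<alpha> + \<beta> + 2 * real n + 1))) else 0) =
      (\<Sum>x\<in>simplex d (N - n).
        c * (g x * (w x * shifted_binom (N - n - (\<Sum>i=1..d. x i)) (\<alpha> + \<beta> + 2 * real n + 1))))"
      using True le(1) by (intro sum.mono_neutral_cong_right finite_simplex) (auto simp: simplex_def)
    also have "\<dots> = c * (\<Sum>x\<in>simplex d (N - n).
       multi_hahn_R d (real (N - n)) (merge_last d n \<sigma>) \<nu> (vec_real x) *
       multi_hahn_R d (real (N - n)) (merge_last d n \<sigma>) \<mu> (vec_real x) *
       hahn_weight d (N - n) (merge_last d n \<sigma>) x)"
      unfolding sum_distrib_left
    proof (rule sum.cong[OF refl])
      fix x
      have "(\<Prod>i=1..d. shifted_binom (x i) (merge_last d n \<sigma> i)) = w x"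
        unfolding w_def by (rule prod.cong) (simp_all add: merge_last_le)
      then have "hahn_weight d (N - n) (merge_last d n \<sigma>) x =
          w x * shifted_binom (N - n - (\<Sum>i=1..d. x i)) (\<alpha> + \<beta> + 2 * real n + 1)"
        unfolding hahn_weight_def by (simp add: merge_last_def \<alpha>_def \<beta>_def)
      then show "c * (g x * (w x * shifted_binom (N - n - (\<Sum>i=1..d. x i)) (\<alpha> + \<beta> + 2 * real n + 1))) =
        c * (multi_hahn_R d (real (N - n)) (merge_last d n \<sigma>) \<nu> (vec_real x) *
          multi_hahn_R d (real (N - n)) (merge_last d n \<sigma>) \<mu> (vec_real x) *
          hahn_weight d (N - n) (merge_last d n \<sigma>) x)"
        using True le(1) by (simp add: g_def of_nat_diff)
    qed
    also have "\<dots> = c * (if \<forall>i\<in>{1..d}. \<nu> i = \<mu> i then multi_hahn_R_norm d (N - n) (merge_last d n \<sigma>) \<nu> else 0)"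
      using Suc.IH[OF le(2)] by simp
    also have "\<dots> = (if \<forall>i\<in>{1..Suc d}. \<nu> i = \<mu> i then multi_hahn_R_norm (Suc d) N \<sigma> \<nu> else 0)"
    proof -
      have "(\<forall>i\<in>{1..Suc d}. \<nu> i = \<mu> i) \<longleftrightarrow> (\<forall>i\<in>{1..d}. \<nu> i = \<mu> i)"
        using True by (auto simp: n_def m_def le_Suc_eq)
      then show ?thesis
        unfolding multi_hahn_R_norm_Suc c_def n_def \<alpha>_def \<beta>_def by simp
    qed
    finally show ?thesis .
  qed
  finally show ?case .
qed

section \<open>The difference operator as a hopping operator\<close>

text \<open>
  The operator \<open>\<Sum> x\<^sub>j (x\<^sub>i + \<sigma>\<^sub>i + 1) (f(x + e\<^sub>i - e\<^sub>j) - f(x))\<close> over distinct \<open>i, j\<close> in \<open>{1..d+1}\<close>,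
  where \<open>x\<^sub>d\<^sub>+\<^sub>1 = N - |x|\<close> and \<open>e\<^sub>d\<^sub>+\<^sub>1 = 0\<close>. The three sums are those with \<open>i, j \<le> d\<close>, with
  \<open>j = d + 1\<close> and with \<open>i = d + 1\<close>.
\<close>

definition hop :: "nat \<Rightarrow> real \<Rightarrow> (nat \<Rightarrow> real) \<Rightarrow> ((nat \<Rightarrow> real) \<Rightarrow> real) \<Rightarrow> (nat \<Rightarrow> real) \<Rightarrow> real" where
  "hop d N \<sigma> f x =
     (\<Sum>i=1..d. \<Sum>j\<in>{1..d} - {i}. x j * (x i + \<sigma> i + 1) * (f (x(i := x i + 1, j := x j - 1)) - f x)) +
     (\<Sum>i=1..d. (N - (\<Sum>m=1..d. x m)) * (x i + \<sigma> i + 1) * (f (x(i := x i + 1)) - f x)) +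
     (\<Sum>i=1..d. x i * (N - (\<Sum>m=1..d. x m) + \<sigma> (d + 1) + 1) * (f (x(i := x i - 1)) - f x))"

text \<open>
  Since \<open>f(x + e\<^sub>i - e\<^sub>j) - f(x) = \<triangle>\<^sub>i f - \<nabla>\<^sub>j f - \<triangle>\<^sub>i \<nabla>\<^sub>j f\<close> for \<open>i \<noteq> j\<close>, and
  \<open>\<triangle>\<^sub>i \<nabla>\<^sub>i = \<triangle>\<^sub>i - \<nabla>\<^sub>i\<close>, it remains to compare the coefficients of \<open>\<triangle>\<^sub>i f\<close> and \<open>\<nabla>\<^sub>i f\<close>.
\<close>

lemma hahn_D_eq_hop: "hahn_D d N \<sigma> f x = hop d (real N) \<sigma> f x"
proof -
  define A where "A = {1..d}"
  have [simp]: "finite A" by (simp add: A_def)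
  \<comment> \<open>\<open>a\<close> is the forward difference, \<open>b\<close> the negated backward difference, \<open>c\<close> the hop.\<close>
  define a b where "a i = f (x(i := x i + 1)) - f x" and "b i = f (x(i := x i - 1)) - f x" for i
  define c where "c i j = f (x(i := x i + 1, j := x j - 1)) - f x" for i j
  define u where "u i = x i + \<sigma> i + 1" for i
  define X s where "X = sum x A" and "s = sum \<sigma> A"
  have s_all: "(\<Sum>m=1..d+1. \<sigma> m) = s + \<sigma> (d + 1)" by (simp add: s_def A_def)
  have U: "sum u A = X + s + real d" by (simp add: u_def X_def s_def sum.distrib A_def)
  have diag: "fwd_diff i (bwd_diff i f) x = a i + b i" for i
    by (simp add: fwd_diff_def bwd_diff_def a_def b_def)
  have offdiag: "fwd_diff i (bwd_diff j f) x = a i + b j - c i j" if "j \<in> A - {i}" for i j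
    using that by (simp add: fwd_diff_def bwd_diff_def a_def b_def c_def)
  have fwd: "fwd_diff i f x = a i" for i by (simp add: fwd_diff_def a_def)
  have a_sum: "(\<Sum>j\<in>A - {i}. x j * u i * a i) = (X - x i) * u i * a i" if "i \<in> A" for i
    using that by (simp add: sum_diff1 X_def flip: sum_distrib_right)
  have "(\<Sum>i\<in>A. \<Sum>j\<in>A - {i}. x j * u i * b j) =
      (\<Sum>i\<in>A. \<Sum>j\<in>A. u i * (x j * b j)) - (\<Sum>i\<in>A. x i * u i * b i)"
    by (simp add: sum_diff1 sum_subtractf mult_ac)
  also have "(\<Sum>i\<in>A. \<Sum>j\<in>A. u i * (x j * b j)) = (\<Sum>i\<in>A. (X + s + real d) * (x i * b i))"
    unfolding sum_product[symmetric] U by (simp add: sum_distrib_left)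
  finally have b_sum: "(\<Sum>i\<in>A. \<Sum>j\<in>A - {i}. x j * u i * b j) = (\<Sum>i\<in>A. (X + s + real d - u i) * x i * b i)"
    by (simp add: sum_subtractf[symmetric] algebra_simps)
  have "(\<Sum>i\<in>A. \<Sum>j\<in>A - {i}. x j * u i * fwd_diff i (bwd_diff j f) x) =
      (\<Sum>i\<in>A. \<Sum>j\<in>A - {i}. x j * u i * a i + x j * u i * b j - x j * u i * c i j)"
    by (intro sum.cong refl) (simp add: offdiag algebra_simps)
  also have "\<dots> = (\<Sum>i\<in>A. (X - x i) * u i * a i) + (\<Sum>i\<in>A. (X + s + real d - u i) * x i * b i) -
      (\<Sum>i\<in>A. \<Sum>j\<in>A - {i}. x j * u i * c i j)"
    using a_sum b_sum by (simp add: sum.distrib sum_subtractf)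
  finally have mixed: "(\<Sum>i\<in>A. \<Sum>j\<in>A - {i}. x j * u i * fwd_diff i (bwd_diff j f) x) = \<dots>" .
  have "hahn_D d N \<sigma> f x =
     (\<Sum>i\<in>A. x i * (real N - x i + (s + \<sigma> (d + 1)) - \<sigma> i + real d) * (a i + b i)) -
     (\<Sum>i\<in>A. \<Sum>j\<in>A - {i}. x j * u i * fwd_diff i (bwd_diff j f) x) +
     (\<Sum>i\<in>A. ((real N - x i) * (\<sigma> i + 1) - x i * ((s + \<sigma> (d + 1)) - \<sigma> i + real d)) * a i)"
    unfolding hahn_D_def s_all diag fwd A_def u_def ..
  also have "\<dots> = (\<Sum>i\<in>A. \<Sum>j\<in>A - {i}. x j * u i * c i j) +
     (\<Sum>i\<in>A. x i * (real N - x i + (s + \<sigma> (d + 1)) - \<sigma> i + real d) * (a i + b i) -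
        (X - x i) * u i * a i - (X + s + real d - u i) * x i * b i +
        ((real N - x i) * (\<sigma> i + 1) - x i * ((s + \<sigma> (d + 1)) - \<sigma> i + real d)) * a i)"
    unfolding mixed by (simp add: sum.distrib sum_subtractf)
  also have "(\<Sum>i\<in>A. x i * (real N - x i + (s + \<sigma> (d + 1)) - \<sigma> i + real d) * (a i + b i) -
        (X - x i) * u i * a i - (X + s + real d - u i) * x i * b i +
        ((real N - x i) * (\<sigma> i + 1) - x i * ((s + \<sigma> (d + 1)) - \<sigma> i + real d)) * a i) =
      (\<Sum>i\<in>A. (real N - X) * u i * a i + x i * (real N - X + \<sigma> (d + 1) + 1) * b i)"
    unfolding u_def by (rule sum.cong) (simp_all add: algebra_simps)
  also have "(\<Sum>i\<in>A. \<Sum>j\<in>A - {i}. x j * u i * c i j) + \<dots> = hop d (real N) \<sigma> f x"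
    unfolding hop_def sum.distrib A_def u_def X_def a_def b_def c_def by simp
  finally show ?thesis .
qed

lemma sum_upd_add:
  fixes x :: "nat \<Rightarrow> real"
  assumes "i \<in> A" "finite A"
  shows "sum (x(i := x i + c)) A = sum x A + c"
proof -
  have "x(i := x i + c) = (\<lambda>k. x k + (if k = i then c else 0))" by auto
  then show ?thesis using assms by (simp add: sum.distrib)
qed

lemma sum_upd_sub:
  fixes x :: "nat \<Rightarrow> real"
  assumes "i \<in> A" "finite A"
  shows "sum (x(i := x i - c)) A = sum x A - c"
  using sum_upd_add[OF assms, of x "- c"] by simp

lemma sum_upd_notin: "i \<notin> A \<Longrightarrow> sum (x(i := v)) A = sum x A"
  by (intro sum.cong) auto

text \<open>
  The product of \<open>R\<^sub>n\<close>, in the last variable, and a function \<open>g\<close> of the other variables. On \<open>g\<close>, the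
  operator acts like the one for the merged problem. The remaining multiple of \<open>f\<close> comes from
  the one-variable eigenvalue and from the diagonal terms, because the contiguous relations
  have factors \<open>M - n\<close> and \<open>M + n + \<alpha> + \<beta> + 2\<close> where the total rates have
  \<open>M\<close> and \<open>M + \<alpha> + \<beta> + 2\<close>.
\<close>

lemma hop_Suc:
  fixes d n :: nat and N :: real and \<sigma> :: "nat \<Rightarrow> real" and x :: "nat \<Rightarrow> real"
  defines "\<alpha> \<equiv> \<sigma> (Suc d)" and "\<beta> \<equiv> \<sigma> (Suc (Suc d))"
  assumes f: "\<And>z. f z = hahn_R n \<alpha> \<beta> (N - (\<Sum>i=1..d. z i)) (z (Suc d)) * g z"
    and g: "\<And>z v. g (z(Suc d := v)) = g z"
  shows "hop (Suc d) N \<sigma> f x =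
    hahn_R n \<alpha> \<beta> (N - (\<Sum>i=1..d. x i)) (x (Suc d)) * hop d (N - real n) (merge_last d n \<sigma>) g x -
    real n * (real n + \<alpha> + \<beta> + 1 + (\<Sum>i=1..d. \<sigma> i + 1)) * f x"
proof -
  define A where "A = {1..d}"
  define D where "D = Suc d"
  have [simp]: "finite A" "D \<notin> A" by (simp_all add: A_def D_def)
  have AD: "{1..Suc d} = insert D A" by (auto simp: A_def D_def)
  have neD: "i \<noteq> D" if "i \<in> A" for i using that by (auto simp: A_def D_def)
  define X M y where "X = sum x A" and "M = N - X" and "y = x D"
  define h where "h = hahn_R n \<alpha> \<beta> M y"
  define u where "u i = x i + \<sigma> i + 1" for i
  define a b where "a i = g (x(i := x i + 1))" and "b i = g (x(i := x i - 1))" for i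
  define c where "c i j = g (x(i := x i + 1, j := x j - 1))" for i j
  note f' = f[folded A_def D_def] and g' = g[folded D_def]
  have fx: "f x = h * g x" by (simp add: f' h_def M_def X_def y_def)
  have move: "f (x(i := x i + 1, j := x j - 1)) = h * c i j" if "i \<in> A" "j \<in> A - {i}" for i j
  proof -
    have "x j - 1 = (x(i := x i + 1)) j - 1" using that by auto
    then have "sum (x(i := x i + 1, j := x j - 1)) A = X"
      using that sum_upd_sub[of j A "x(i := x i + 1)" 1] sum_upd_add[of i A x 1] by (simp add: X_def)
    then show ?thesis using that neD by (auto simp: f' h_def M_def y_def c_def)
  qed
  have sum_up: "sum (x(i := x i + 1)) A = X + 1" and sum_down: "sum (x(i := x i - 1)) A = X - 1"
    if "i \<in> A" for i
    unfolding X_def using that by (simp_all only: sum_upd_add sum_upd_sub \<open>finite A\<close>)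
  have up: "f (x(i := x i + 1)) = hahn_R n \<alpha> \<beta> (M - 1) y * a i" if "i \<in> A" for i
    unfolding f' sum_up[OF that] using neD[OF that] by (simp add: a_def M_def y_def algebra_simps)
  have down: "f (x(i := x i - 1)) = hahn_R n \<alpha> \<beta> (M + 1) y * b i" if "i \<in> A" for i
    unfolding f' sum_down[OF that] using neD[OF that] by (simp add: b_def M_def y_def algebra_simps)
  have up_D: "f (x(i := x i + 1, D := x D - 1)) = hahn_R n \<alpha> \<beta> (M - 1) (y - 1) * a i" if "i \<in> A" for i
    unfolding f' g' sum_upd_notin[OF \<open>D \<notin> A\<close>] sum_up[OF that]
    by (simp add: a_def M_def y_def algebra_simps)
  have down_D: "f (x(D := x D + 1, i := x i - 1)) = hahn_R n \<alpha> \<beta> (M + 1) (y + 1) * b i" if "i \<in> A" for i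
  proof -
    have "x(D := x D + 1, i := x i - 1) = x(i := x i - 1, D := x D + 1)"
      using neD[OF that] by (rule fun_upd_twist[symmetric])
    then show ?thesis
      unfolding f' g' sum_upd_notin[OF \<open>D \<notin> A\<close>]
      by (simp only: g' sum_upd_notin[OF \<open>D \<notin> A\<close>] sum_down[OF that] fun_upd_same)
         (simp add: b_def M_def y_def algebra_simps)
  qed
  have last: "f (x(D := v)) = hahn_R n \<alpha> \<beta> M v * g x" for v
    unfolding f' g' sum_upd_notin[OF \<open>D \<notin> A\<close>] by (simp add: M_def X_def)
  have MX: "N - sum x (insert D A) = M - y" by (simp add: M_def X_def y_def)
  have sets: "insert D A - {D} = A" "i \<in> A \<Longrightarrow> insert D A - {i} = insert D (A - {i})" for i
    using neD by auto
  have \<sigma>_D: "\<sigma> D = \<alpha>" by (simp add: \<alpha>_def D_def)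
  have moves: "(\<Sum>i\<in>A. \<Sum>j\<in>A - {i}. x j * u i * (f (x(i := x i + 1, j := x j - 1)) - f x)) =
      (\<Sum>i\<in>A. \<Sum>j\<in>A - {i}. x j * u i * (h * c i j - f x))"
    by (intro sum.cong refl) (simp only: move)
  \<comment> \<open>The first bracket has the hops within \<open>{1..d+1}\<close>, the other two those from and to site \<open>d + 2\<close>.\<close>
  have "hop (Suc d) N \<sigma> f x =
     ((\<Sum>i\<in>A. \<Sum>j\<in>A - {i}. x j * u i * (f (x(i := x i + 1, j := x j - 1)) - f x)) +
      (\<Sum>i\<in>A. y * u i * (f (x(i := x i + 1, D := x D - 1)) - f x)) +
      (\<Sum>i\<in>A. x i * (y + \<alpha> + 1) * (f (x(D := x D + 1, i := x i - 1)) - f x))) +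
     ((\<Sum>i\<in>A. (M - y) * u i * (f (x(i := x i + 1)) - f x)) +
      (M - y) * (y + \<alpha> + 1) * (f (x(D := y + 1)) - f x)) +
     ((\<Sum>i\<in>A. x i * (M - y + \<beta> + 1) * (f (x(i := x i - 1)) - f x)) +
      y * (M - y + \<beta> + 1) * (f (x(D := y - 1)) - f x))"
    unfolding hop_def AD MX u_def
    by (simp add: sets \<sigma>_D sum.distrib y_def[symmetric] \<beta>_def cong: sum.cong)
  also have "\<dots> = (\<Sum>i\<in>A. \<Sum>j\<in>A - {i}. x j * u i * (h * c i j - f x)) +
     (\<Sum>i\<in>A. y * u i * (hahn_R n \<alpha> \<beta> (M - 1) (y - 1) * a i - f x) +
        (M - y) * u i * (hahn_R n \<alpha> \<beta> (M - 1) y * a i - f x)) +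
     (\<Sum>i\<in>A. x i * (y + \<alpha> + 1) * (hahn_R n \<alpha> \<beta> (M + 1) (y + 1) * b i - f x) +
        x i * (M - y + \<beta> + 1) * (hahn_R n \<alpha> \<beta> (M + 1) y * b i - f x)) +
     ((y + \<alpha> + 1) * (M - y) * (hahn_R n \<alpha> \<beta> M (y + 1) - h) +
      y * (M - y + \<beta> + 1) * (hahn_R n \<alpha> \<beta> M (y - 1) - h)) * g x"
    unfolding moves
    by (simp add: up down up_D down_D last sum.distrib fx[symmetric] cong: sum.cong)
       (simp add: fx algebra_simps)
  also have "(y + \<alpha> + 1) * (M - y) * (hahn_R n \<alpha> \<beta> M (y + 1) - h) +
      y * (M - y + \<beta> + 1) * (hahn_R n \<alpha> \<beta> M (y - 1) - h) = - real n * (real n + \<alpha> + \<beta> + 1) * h"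
    unfolding h_def by (rule hahn_R_difference_equation)
  also have "(\<Sum>i\<in>A. y * u i * (hahn_R n \<alpha> \<beta> (M - 1) (y - 1) * a i - f x) +
        (M - y) * u i * (hahn_R n \<alpha> \<beta> (M - 1) y * a i - f x)) =
     (\<Sum>i\<in>A. (M - real n) * u i * (h * (a i - g x)) - real n * f x * u i)"
  proof (rule sum.cong[OF refl])
    fix i
    show "y * u i * (hahn_R n \<alpha> \<beta> (M - 1) (y - 1) * a i - f x) +
        (M - y) * u i * (hahn_R n \<alpha> \<beta> (M - 1) y * a i - f x) =
      (M - real n) * u i * (h * (a i - g x)) - real n * f x * u i"
      using hahn_R_remove_one[of y n \<alpha> \<beta> M] unfolding fx h_def[symmetric] by algebra
  qed
  also have "(\<Sum>i\<in>A. x i * (y + \<alpha> + 1) * (hahn_R n \<alpha> \<beta> (M + 1) (y + 1) * b i - f x) +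
        x i * (M - y + \<beta> + 1) * (hahn_R n \<alpha> \<beta> (M + 1) y * b i - f x)) =
     (\<Sum>i\<in>A. (M + real n + \<alpha> + \<beta> + 2) * x i * (h * (b i - g x)) + real n * f x * x i)"
  proof (rule sum.cong[OF refl])
    fix i
    show "x i * (y + \<alpha> + 1) * (hahn_R n \<alpha> \<beta> (M + 1) (y + 1) * b i - f x) +
        x i * (M - y + \<beta> + 1) * (hahn_R n \<alpha> \<beta> (M + 1) y * b i - f x) =
      (M + real n + \<alpha> + \<beta> + 2) * x i * (h * (b i - g x)) + real n * f x * x i"
      using hahn_R_add_one[of y \<alpha> n \<beta> M] unfolding fx h_def[symmetric] by algebra
  qed
  also have "(\<Sum>i\<in>A. \<Sum>j\<in>A - {i}. x j * u i * (h * c i j - f x)) +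
     (\<Sum>i\<in>A. (M - real n) * u i * (h * (a i - g x)) - real n * f x * u i) +
     (\<Sum>i\<in>A. (M + real n + \<alpha> + \<beta> + 2) * x i * (h * (b i - g x)) + real n * f x * x i) +
     - real n * (real n + \<alpha> + \<beta> + 1) * h * g x =
     h * ((\<Sum>i\<in>A. \<Sum>j\<in>A - {i}. x j * u i * (c i j - g x)) +
       (\<Sum>i\<in>A. (M - real n) * u i * (a i - g x)) +
       (\<Sum>i\<in>A. x i * (M + real n + \<alpha> + \<beta> + 2) * (b i - g x))) -
     real n * (real n + \<alpha> + \<beta> + 1 + (\<Sum>i\<in>A. \<sigma> i + 1)) * f x"
  proof -
    have 1: "(\<Sum>i\<in>A. \<Sum>j\<in>A - {i}. x j * u i * (h * c i j - f x)) =
        h * (\<Sum>i\<in>A. \<Sum>j\<in>A - {i}. x j * u i * (c i j - g x))"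
      unfolding fx sum_distrib_left by (intro sum.cong refl) (simp add: algebra_simps)
    have 2: "(\<Sum>i\<in>A. (M - real n) * u i * (h * (a i - g x)) - real n * f x * u i) =
        h * (\<Sum>i\<in>A. (M - real n) * u i * (a i - g x)) - real n * f x * sum u A"
      unfolding sum_distrib_left sum_subtractf[symmetric] by (intro sum.cong refl) (simp add: algebra_simps)
    have 3: "(\<Sum>i\<in>A. (M + real n + \<alpha> + \<beta> + 2) * x i * (h * (b i - g x)) + real n * f x * x i) =
        h * (\<Sum>i\<in>A. x i * (M + real n + \<alpha> + \<beta> + 2) * (b i - g x)) + real n * f x * X"
      unfolding sum_distrib_left X_def sum.distrib[symmetric] by (intro sum.cong refl) (simp add: algebra_simps)
    have 4: "sum u A = X + (\<Sum>i\<in>A. \<sigma> i + 1)"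
      unfolding u_def X_def sum.distrib[symmetric] by (simp add: add.assoc)
    show ?thesis unfolding 1 2 3 4 unfolding fx by algebra
  qed
  also have "(\<Sum>i\<in>A. \<Sum>j\<in>A - {i}. x j * u i * (c i j - g x)) +
       (\<Sum>i\<in>A. (M - real n) * u i * (a i - g x)) +
       (\<Sum>i\<in>A. x i * (M + real n + \<alpha> + \<beta> + 2) * (b i - g x)) =
     hop d (N - real n) (merge_last d n \<sigma>) g x"
  proof -
    have u: "x i + merge_last d n \<sigma> i + 1 = u i" if "i \<in> A" for i
      using that by (simp add: A_def merge_last_le u_def)
    have M': "N - real n - sum x A = M - real n"
      and \<sigma>': "M - real n + merge_last d n \<sigma> (d + 1) + 1 = M + real n + \<alpha> + \<beta> + 2"
      by (simp_all add: M_def X_def merge_last_def \<alpha>_def \<beta>_def)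
    show ?thesis
      unfolding hop_def A_def[symmetric] M' \<sigma>' a_def b_def c_def by (simp add: u cong: sum.cong)
  qed
  finally show ?thesis
    unfolding h_def M_def X_def y_def A_def D_def .
qed

lemma multi_hahn_R_eigenfunction:
  "hop d N \<sigma> (multi_hahn_R d N \<sigma> \<nu>) x =
     hahn_eigenvalue d \<sigma> (\<Sum>i=1..d. \<nu> i) * multi_hahn_R d N \<sigma> \<nu> x"
proof (induction d arbitrary: N \<sigma>)
  case 0
  then show ?case by (simp add: hop_def hahn_eigenvalue_def)
next
  case (Suc d)
  define n where "n = \<nu> (Suc d)"
  define k where "k = (\<Sum>i=1..d. \<nu> i)"
  have "hop (Suc d) N \<sigma> (multi_hahn_R (Suc d) N \<sigma> \<nu>) x =
      hahn_R n (\<sigma> (Suc d)) (\<sigma> (Suc (Suc d))) (N - (\<Sum>i=1..d. x i)) (x (Suc d)) *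
      hop d (N - real n) (merge_last d n \<sigma>) (multi_hahn_R d (N - real n) (merge_last d n \<sigma>) \<nu>) x -
      real n * (real n + \<sigma> (Suc d) + \<sigma> (Suc (Suc d)) + 1 + (\<Sum>i=1..d. \<sigma> i + 1)) *
      multi_hahn_R (Suc d) N \<sigma> \<nu> x"
    by (rule hop_Suc) (auto simp: multi_hahn_R_Suc n_def intro!: multi_hahn_R_cong)
  also have "\<dots> = (hahn_eigenvalue d (merge_last d n \<sigma>) k -
      real n * (real n + \<sigma> (Suc d) + \<sigma> (Suc (Suc d)) + 1 + (\<Sum>i=1..d. \<sigma> i + 1))) *
      multi_hahn_R (Suc d) N \<sigma> \<nu> x"
    unfolding Suc.IH multi_hahn_R_Suc n_def[symmetric] k_def by (simp add: algebra_simps)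
  also have "hahn_eigenvalue d (merge_last d n \<sigma>) k -
      real n * (real n + \<sigma> (Suc d) + \<sigma> (Suc (Suc d)) + 1 + (\<Sum>i=1..d. \<sigma> i + 1)) =
      hahn_eigenvalue (Suc d) \<sigma> (k + n)"
  proof -
    define s where "s = (\<Sum>i=1..d. \<sigma> i)"
    have "(\<Sum>m=1..d+1. merge_last d n \<sigma> m) = s + \<sigma> (Suc d) + \<sigma> (Suc (Suc d)) + 2 * real n + 1"
      using sum_merge_last[of 0 d n \<sigma>] by (simp add: s_def)
    moreover have "(\<Sum>i=1..d. \<sigma> i + 1) = s + real d" by (simp add: s_def sum.distrib)
    moreover have "(\<Sum>m=1..Suc d+1. \<sigma> m) = s + \<sigma> (Suc d) + \<sigma> (Suc (Suc d))" by (simp add: s_def)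
    ultimately show ?thesis
      unfolding hahn_eigenvalue_def by (simp only: of_nat_add of_nat_Suc) (simp add: algebra_simps)
  qed
  finally show ?case by (simp add: k_def n_def)
qed

section \<open>The normalized polynomials on the truncated simplex\<close>

lemma hop_scale: "hop d N \<sigma> (\<lambda>x. c * f x) x = c * hop d N \<sigma> f x"
  unfolding hop_def right_diff_distrib[symmetric] distrib_left sum_distrib_left by (simp only: mult_ac)

text \<open>The constant factor of \<open>Q\<^sub>\<nu>\<close>; it is zero if some \<open>(a\<^sub>j + 1)\<^bsub>\<nu>\<^sub>j\<^esub>\<close> vanishes.\<close>

definition hahn_Q_const :: "nat \<Rightarrow> nat \<Rightarrow> (nat \<Rightarrow> real) \<Rightarrow> (nat \<Rightarrow> nat) \<Rightarrow> real" where
  "hahn_Q_const d N \<sigma> \<nu> = (- 1) ^ (\<Sum>i=1..d. \<nu> i) / pochhammer (- real N) (\<Sum>i=1..d. \<nu> i) /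
     (\<Prod>j=1..d. pochhammer (hahn_a d \<sigma> \<nu> j + 1) (\<nu> j))"

lemma multi_hahn_Q_eq:
  assumes "\<And>j. j \<in> {1..d} \<Longrightarrow> pochhammer (\<sigma> j + 1) (\<nu> j) \<noteq> 0"
  shows "multi_hahn_Q d N \<sigma> \<nu> = (\<lambda>x. hahn_Q_const d N \<sigma> \<nu> * multi_hahn_R d (real N) \<sigma> \<nu> x)"
proof
  fix x
  have "(\<Prod>j=1..d. pochhammer (\<sigma> j + 1) (\<nu> j) / pochhammer (hahn_a d \<sigma> \<nu> j + 1) (\<nu> j) *
        hahn_Q_scaled (\<nu> j) (x j) (\<sigma> j) (hahn_a d \<sigma> \<nu> j)
          (real N - (\<Sum>i=1..<j. x i) - real (\<Sum>i=j+1..d. \<nu> i))) =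
      (\<Prod>j=1..d. hahn_R (\<nu> j) (\<sigma> j) (hahn_a d \<sigma> \<nu> j)
          (real N - (\<Sum>i=1..<j. x i) - real (\<Sum>i=j+1..d. \<nu> i)) (x j) /
        pochhammer (hahn_a d \<sigma> \<nu> j + 1) (\<nu> j))"
    by (rule prod.cong) (simp_all add: hahn_R_eq_scaled assms)
  then show "multi_hahn_Q d N \<sigma> \<nu> x = hahn_Q_const d N \<sigma> \<nu> * multi_hahn_R d (real N) \<sigma> \<nu> x"
    unfolding multi_hahn_Q_def hahn_Q_const_def multi_hahn_R_def by (simp add: prod_dividef)
qed

text \<open>
  With \<open>P\<close> the product of the \<open>(a\<^sub>j + 1)\<^bsub>\<nu>\<^sub>j\<^esub>\<close>, the squared constant has \<open>1 / P\<^sup>2\<close> and the norm has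
  \<open>P\<close>, while \<open>A\<^sub>\<nu>\<close> has \<open>1 / P\<close>. With \<open>1 / 0 = 0\<close> this matches also if \<open>P = 0\<close>.
\<close>

lemma hahn_norm_eq:
  assumes "(\<Sum>i=1..d. \<nu> i) \<le> N"
  shows "hahn_norm d N \<sigma> \<nu> = (hahn_Q_const d N \<sigma> \<nu>)\<^sup>2 * multi_hahn_R_norm d N \<sigma> \<nu>"
proof -
  define n where "n = (\<Sum>i=1..d. \<nu> i)"
  define P where "P = (\<Prod>j=1..d. pochhammer (hahn_a d \<sigma> \<nu> j + 1) (\<nu> j))"
  define B where "B = (\<Prod>j=1..d. pochhammer (\<sigma> j + hahn_a d \<sigma> \<nu> j + real (\<nu> j) + 1) (\<nu> j) *
        pochhammer (\<sigma> j + 1) (\<nu> j) * fact (\<nu> j))"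
  define T where "T = pochhammer ((\<Sum>m=1..d+1. \<sigma> m) + real d + 2 * real n + 1) (N - n)"
  have p: "pochhammer (- real N) n = (- 1) ^ n * (fact N / fact (N - n))"
  proof -
    have 1: "(fact N :: real) = fact (N - n) * pochhammer (real (N - n) + 1) n"
      using pochhammer_product'[of "1 :: real" "N - n" n] assms
      by (simp add: n_def add.commute flip: pochhammer_fact)
    have 2: "real N - real n + 1 = real (N - n) + 1" using assms by (simp add: n_def of_nat_diff)
    show ?thesis unfolding pochhammer_minus 1 2 by simp
  qed
  have "(\<Prod>j=1..d. pochhammer (\<sigma> j + hahn_a d \<sigma> \<nu> j + real (\<nu> j) + 1) (\<nu> j) *
        pochhammer (\<sigma> j + 1) (\<nu> j) * fact (\<nu> j) / pochhammer (hahn_a d \<sigma> \<nu> j + 1) (\<nu> j)) = B / P"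
    by (simp add: B_def P_def prod_dividef)
  then have "hahn_norm d N \<sigma> \<nu> = T / (fact N * fact N / fact (N - n)) * (B / P)"
    unfolding hahn_norm_def n_def[symmetric] T_def[symmetric] p by simp
  moreover have "(\<Prod>j=1..d. pochhammer (\<sigma> j + 1) (\<nu> j) * pochhammer (hahn_a d \<sigma> \<nu> j + 1) (\<nu> j) * fact (\<nu> j) *
        pochhammer (real (\<nu> j) + \<sigma> j + hahn_a d \<sigma> \<nu> j + 1) (\<nu> j)) = B * P"
    unfolding B_def P_def prod.distrib[symmetric] by (rule prod.cong) (simp_all add: add_ac)
  then have "multi_hahn_R_norm d N \<sigma> \<nu> = T / fact (N - n) * (B * P)"
    unfolding multi_hahn_R_norm_def n_def[symmetric] shifted_binom_def T_def by simp
  moreover have "hahn_Q_const d N \<sigma> \<nu> = fact (N - n) / fact N / P"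
    unfolding hahn_Q_const_def n_def[symmetric] P_def[symmetric] p by simp
  ultimately show ?thesis by (simp add: power2_eq_square mult_ac)
qed

lemma sum_V_set_eq_sum_simplex:
  fixes F :: "(nat \<Rightarrow> nat) \<Rightarrow> real"
  assumes "S \<subseteq> {1..d}" and "\<And>i. i \<in> S \<Longrightarrow> \<sigma> i = - real (l i) - 1"
  shows "(\<Sum>x\<in>V_set d N S l. F x * hahn_weight d N \<sigma> x) =
     (\<Sum>x\<in>simplex d N. F x * hahn_weight d N \<sigma> x)"
proof (rule sum.mono_neutral_left)
  show "V_set d N S l \<subseteq> simplex d N" by (auto simp: V_set_def simplex_def)
  show "\<forall>x\<in>simplex d N - V_set d N S l. F x * hahn_weight d N \<sigma> x = 0"
  proof
    fix x assume "x \<in> simplex d N - V_set d N S l"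
    then obtain i where i: "i \<in> S" "l i < x i" by (auto simp: V_set_def simplex_def not_le)
    then have "shifted_binom (x i) (\<sigma> i) = 0"
      by (simp add: assms(2) shifted_binom_def pochhammer_of_nat_eq_0_lemma)
    then have "(\<Prod>i=1..d. shifted_binom (x i) (\<sigma> i)) = 0"
      using i(1) assms(1) by (intro prod_zero) auto
    then show "F x * hahn_weight d N \<sigma> x = 0" by (simp add: hahn_weight_def)
  qed
qed (rule finite_simplex)

lemma pochhammer_neq_0_on_V_set:
  assumes "\<And>i. i \<in> S \<Longrightarrow> \<sigma> i = - real (l i) - 1"
    and "\<And>i. i \<in> {1..d} - S \<Longrightarrow> - \<sigma> i \<notin> real ` {1..N}"
    and \<nu>: "\<nu> \<in> V_set d N S l" and j: "j \<in> {1..d}"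
  shows "pochhammer (\<sigma> j + 1) (\<nu> j) \<noteq> 0"
proof (cases "j \<in> S")
  case True
  then have "\<nu> j \<le> l j" using \<nu> by (auto simp: V_set_def)
  then show ?thesis using assms(1)[OF True] by (simp add: pochhammer_of_nat_eq_0_lemma')
next
  case False
  have "\<nu> j \<le> (\<Sum>i=1..d. \<nu> i)" using j by (intro member_le_sum) auto
  then have le: "\<nu> j \<le> N" using \<nu> by (auto simp: V_set_def)
  show ?thesis
  proof
    assume "pochhammer (\<sigma> j + 1) (\<nu> j) = 0"
    then obtain k where "k < \<nu> j" "\<sigma> j + 1 = - real k" unfolding pochhammer_eq_0_iff by auto
    then have "- \<sigma> j = real (Suc k)" "Suc k \<in> {1..N}" using le by auto
    then have "- \<sigma> j \<in> real ` {1..N}" by (rule image_eqI)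
    then show False using assms(2)[of j] j False by blast
  qed
qed

theorem theorem5p5:
  fixes d N :: nat and S :: "nat set" and l :: "nat \<Rightarrow> nat" and \<sigma> :: "nat \<Rightarrow> real"
  assumes "d > 1" and "N > 0"
    and "S \<subseteq> {1..d}" and "S \<noteq> {}"
    and "\<And>i. i \<in> S \<Longrightarrow> 1 \<le> l i \<and> l i \<le> N - 1"
    and "S = {1..d} \<Longrightarrow> (\<Sum>i=1..d. l i) > N"
    and "\<And>i. i \<in> S \<Longrightarrow> \<sigma> i = - real (l i) - 1"
    and "\<And>i. i \<in> {1..d} - S \<Longrightarrow> - \<sigma> i \<notin> real ` {1..N}"
    and "(\<forall>x\<in>V_set d N S l. hahn_weight d N \<sigma> x > 0) \<or>
         (\<forall>x\<in>V_set d N S l. hahn_weight d N \<sigma> x < 0)"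
  shows "(\<forall>\<nu>\<in>V_set d N S l. \<forall>x\<in>V_set d N S l.
            hahn_D d N \<sigma> (multi_hahn_Q d N \<sigma> \<nu>) (vec_real x) =
            hahn_eigenvalue d \<sigma> (\<Sum>i=1..d. \<nu> i) * multi_hahn_Q d N \<sigma> \<nu> (vec_real x)) \<and>
         (\<forall>\<nu>\<in>V_set d N S l. \<forall>\<mu>\<in>V_set d N S l.
            (\<Sum>x\<in>V_set d N S l. multi_hahn_Q d N \<sigma> \<nu> (vec_real x) * multi_hahn_Q d N \<sigma> \<mu> (vec_real x) *
               hahn_weight d N \<sigma> x) =
            (if \<nu> = \<mu> then hahn_norm d N \<sigma> \<nu> else 0))"
proof (intro conjI ballI)
  have Q: "multi_hahn_Q d N \<sigma> \<nu> = (\<lambda>x. hahn_Q_const d N \<sigma> \<nu> * multi_hahn_R d (real N) \<sigma> \<nu> x)"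
    if "\<nu> \<in> V_set d N S l" for \<nu>
    using pochhammer_neq_0_on_V_set[OF assms(7,8) that] by (rule multi_hahn_Q_eq)
  {
    fix \<nu> x assume "\<nu> \<in> V_set d N S l"
    then show "hahn_D d N \<sigma> (multi_hahn_Q d N \<sigma> \<nu>) (vec_real x) =
        hahn_eigenvalue d \<sigma> (\<Sum>i=1..d. \<nu> i) * multi_hahn_Q d N \<sigma> \<nu> (vec_real x)"
      by (simp add: Q hahn_D_eq_hop hop_scale multi_hahn_R_eigenfunction)
  }
  fix \<nu> \<mu> assume \<nu>: "\<nu> \<in> V_set d N S l" and \<mu>: "\<mu> \<in> V_set d N S l"
  have le: "(\<Sum>i=1..d. \<nu> i) \<le> N" using \<nu> by (simp add: V_set_def)
  have eq: "(\<forall>i\<in>{1..d}. \<nu> i = \<mu> i) \<longleftrightarrow> \<nu> = \<mu>"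
    using \<nu> \<mu> unfolding V_set_def fun_eq_iff by (metis (mono_tags, lifting) mem_Collect_eq)
  have "(\<Sum>x\<in>V_set d N S l. multi_hahn_Q d N \<sigma> \<nu> (vec_real x) * multi_hahn_Q d N \<sigma> \<mu> (vec_real x) *
        hahn_weight d N \<sigma> x) =
     hahn_Q_const d N \<sigma> \<nu> * hahn_Q_const d N \<sigma> \<mu> *
     (\<Sum>x\<in>simplex d N. multi_hahn_R d (real N) \<sigma> \<nu> (vec_real x) *
        multi_hahn_R d (real N) \<sigma> \<mu> (vec_real x) * hahn_weight d N \<sigma> x)"
    unfolding Q[OF \<nu>] Q[OF \<mu>] sum_distrib_left
    by (subst sum_V_set_eq_sum_simplex[OF assms(3,7)]) (simp_all only: mult_ac)
  also have "\<dots> = (if \<nu> = \<mu> then hahn_norm d N \<sigma> \<nu> else 0)"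
    unfolding multi_hahn_R_orthogonality[OF le] eq hahn_norm_eq[OF le] by (simp add: power2_eq_square)
  finally show "(\<Sum>x\<in>V_set d N S l. multi_hahn_Q d N \<sigma> \<nu> (vec_real x) *
      multi_hahn_Q d N \<sigma> \<mu> (vec_real x) * hahn_weight d N \<sigma> x) =
    (if \<nu> = \<mu> then hahn_norm d N \<sigma> \<nu> else 0)" .
qed

end
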